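(* Let $\varepsilon\in\{1,-1\}$, let $r\ge0$ and $m\ge0$ be integers, and let $a,b,c_0,\lambda\in\mathbb{C}$ with $\operatorname{Re}\lambda>-1$, $c_0\notin\{0,-1,-2,\ldots\}$ and $\operatorname{Re}(c_0-a-b)>-1$. Suppose that $(j+\lambda+1-a)(j+\lambda+1-b)\ne0$ for $1\le j\le m$, and put $$\rho_j=\frac{(j+\lambda)(j+\lambda+1-c_0)}{\varepsilon(j+\lambda+1-a)(j+\lambda+1-b)}.$$ Then $$\Psi_{m,r,\varepsilon}(\lambda;a,b,c_0)=\left(\prod_{\ell=1}^{m}\rho_\ell\right)\Psi_{0,r,\varepsilon}(\lambda;a,b,c_0)+\sum_{j=1}^{m}\frac{r(j+\lambda)\,\Psi_{j-1,r-1,\varepsilon}(\lambda;a,b,c_0)+E_{\varepsilon,r}(j+\lambda;a,b,c_0)}{\varepsilon(j+\lambda+1-a)(j+\lambda+1-b)}\prod_{\ell=j+1}^{m}\rho_\ell,$$ where the term containing $\Psi_{j-1,r-1,\varepsilon}$ is omitted when $r=0$. Empty products are $1$, and the sum is empty when $m=0$.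
   Context: Notation: $(u)_0=1$, $(u)_n=u(u+1)\cdots(u+n-1)$. The complete exponential Bell polynomials $\mathcal B_r$ are defined by $\exp\bigl(\sum_{j\ge1}x_j\frac{t^j}{j!}\bigr)=\sum_{r\ge0}\mathcal B_r(x_1,\ldots,x_r)\frac{t^r}{r!}$, $\mathcal B_0=1$. The shifted harmonic numbers are $H_n^{(s)}(c_0)=\sum_{k=0}^{n-1}\frac1{(c_0+k)^s}$, $H_0^{(s)}(c_0)=0$, and $$\mathcal H_r(n;c_0)=\mathcal B_r\bigl(H_n^{(1)}(c_0),1!\,H_n^{(2)}(c_0),\ldots,(r-1)!\,H_n^{(r)}(c_0)\bigr).$$ The harmonic moments are $$\Psi_{m,r,\varepsilon}(\lambda;a,b,c_0)=\sum_{n=0}^{\infty}\frac{\varepsilon^n(a)_n(b)_n}{(c_0)_n n!}\,\frac{\mathcal H_r(n;c_0)}{n+m+1+\lambda}.$$ Define $$E_{\varepsilon,r}(M;a,b,c_0)=(-1)^r\left.\frac{\partial^r}{\partial c^r}E_\varepsilon(M;a,b,c)\right|_{c=c_0},$$ where for $\varepsilon=1$, $E_+(M;a,b,c)=\frac{\Gamma(c)\Gamma(c-a-b+1)}{\Gamma(c-a)\Gamma(c-b)}$ (independent of $M$; $1/\Gamma(z)=0$ at non-positive integers $z$), and for $\varepsilon=-1$, $$E_-(M;a,b,c)=(c+a+b-2M-2)\,{}_2F_1(a,b;c;-1)-2\left.\frac{d}{dz}{}_2F_1(a,b;c;z)\right|_{z=-1},$$ with ${}_2F_1(a,b;c;z)$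 the Gauss hypergeometric function continued analytically to $\mathbb{C}\setminus[1,\infty)$ (principal branch). *)

theory Defs
  imports "HOL-Complex_Analysis.Complex_Analysis"
begin

text \<open>Complete exponential Bell polynomials, through their generating function.
  The variables are a sequence x; only x 1, ..., x r enter into the r-th polynomial
  (the value x 0 is ignored).\<close>

definition bell_gf_exponent :: "(nat \<Rightarrow> complex) \<Rightarrow> complex fps" where
  "bell_gf_exponent x = Abs_fps (\<lambda>j. if j = 0 then 0 else x j / fact j)"

definition complete_bell :: "nat \<Rightarrow> (nat \<Rightarrow> complex) \<Rightarrow> complex" where
  "complete_bell r x = fact r * fps_nth (fps_compose (fps_exp 1) (bell_gf_exponent x)) r"

definition shifted_harmonic :: "nat \<Rightarrow> nat \<Rightarrow> complex \<Rightarrow> complex" where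
  "shifted_harmonic s n c0 = (\<Sum>k<n. 1 / (c0 + of_nat k) ^ s)"

definition bell_harmonic :: "nat \<Rightarrow> nat \<Rightarrow> complex \<Rightarrow> complex" where
  "bell_harmonic r n c0 = complete_bell r (\<lambda>j. fact (j - 1) * shifted_harmonic j n c0)"

definition harmonic_moment ::
  "nat \<Rightarrow> nat \<Rightarrow> complex \<Rightarrow> complex \<Rightarrow> complex \<Rightarrow> complex \<Rightarrow> complex \<Rightarrow> complex" where
  "harmonic_moment m r \<epsilon> lam a b c0 =
     (\<Sum>n. \<epsilon> ^ n * pochhammer a n * pochhammer b n / (pochhammer c0 n * fact n)
          * (bell_harmonic r n c0 / (of_nat n + of_nat m + 1 + lam)))"

definition hypergeo_cut_plane :: "complex set" where
  "hypergeo_cut_plane = - (complex_of_real ` {1..})"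

text \<open>The Gauss hypergeometric function: the holomorphic continuation of the power series
  to the cut plane. The cut plane is connected, so the continuation is determined on it by
  the identity theorem; outside it the value is arbitrary.\<close>

definition is_hypergeo_continuation ::
  "complex \<Rightarrow> complex \<Rightarrow> complex \<Rightarrow> (complex \<Rightarrow> complex) \<Rightarrow> bool" where
  "is_hypergeo_continuation a b c f \<longleftrightarrow>
     f holomorphic_on hypergeo_cut_plane \<and>
     (\<forall>z. norm z < 1 \<longrightarrow>
        (\<lambda>n. pochhammer a n * pochhammer b n / (pochhammer c n * fact n) * z ^ n) sums f z)"

definition gauss_hypergeo :: "complex \<Rightarrow> complex \<Rightarrow> complex \<Rightarrow> complex \<Rightarrow> complex" where
  "gauss_hypergeo a b c = (SOME f. is_hypergeo_continuation a b c f)"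

text \<open>\<^const>\<open>rGamma\<close> is the entire function 1/Gamma, with value 0 at the non-positive integers.\<close>

definition E_plus :: "complex \<Rightarrow> complex \<Rightarrow> complex \<Rightarrow> complex \<Rightarrow> complex" where
  "E_plus M a b c = Gamma c * Gamma (c - a - b + 1) * rGamma (c - a) * rGamma (c - b)"

definition E_minus :: "complex \<Rightarrow> complex \<Rightarrow> complex \<Rightarrow> complex \<Rightarrow> complex" where
  "E_minus M a b c =
     (c + a + b - 2 * M - 2) * gauss_hypergeo a b c (-1) - 2 * deriv (gauss_hypergeo a b c) (-1)"

definition E_base :: "complex \<Rightarrow> complex \<Rightarrow> complex \<Rightarrow> complex \<Rightarrow> complex \<Rightarrow> complex" where
  "E_base \<epsilon> M a b c = (if \<epsilon> = 1 then E_plus M a b c else E_minus M a b c)"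

definition E_term :: "complex \<Rightarrow> nat \<Rightarrow> complex \<Rightarrow> complex \<Rightarrow> complex \<Rightarrow> complex \<Rightarrow> complex" where
  "E_term \<epsilon> r M a b c0 = (-1) ^ r * (deriv ^^ r) (\<lambda>c. E_base \<epsilon> M a b c) c0"

definition rho :: "complex \<Rightarrow> complex \<Rightarrow> complex \<Rightarrow> complex \<Rightarrow> complex \<Rightarrow> nat \<Rightarrow> complex" where
  "rho \<epsilon> lam a b c0 j =
     (of_nat j + lam) * (of_nat j + lam + 1 - c0)
       / (\<epsilon> * (of_nat j + lam + 1 - a) * (of_nat j + lam + 1 - b))"

end

theory Submission
  imports Defs
begin

text \<open>Write f(n; c) for the Taylor coefficients of the Gauss series with lower parameter c, and
  \<Phi>(s; c) for the sum of \<epsilon>^n f(n; c) / (n + s). Two facts carry the theorem.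

  First, the harmonic moments are parameter derivatives. The quotient of (c)_n by (c - t)_n is the
  product of the 1 / (1 - t / (c + k)) for k < n, and the coefficients of its logarithm
  are the shifted harmonic numbers of order j divided by j. So the Bell polynomial of the harmonic numbers, divided by (c)_n, is
  (-1)^r times the r-th derivative in c of 1 / (c)_n (bell_harmonic_eq_higher_deriv). On the half
  plane Re (c - a - b) > -1 without the poles 0, -1, -2, ... the series \<Phi> converges locally uniformly in c
  (hypergeo_coeff_local_majorant), hence may be differentiated termwise, and the harmonic moment
  with indices m and r is (-1)^r times the r-th derivative of \<Phi>(m + 1 + \<lambda>; c)
  (harmonic_moment_eq).

  Second, for r = 0 there is a two-term recurrence: with M = m + \<lambda>,
  \<epsilon> (M + 1 - a) (M + 1 - b) \<Phi>(M + 1; c) - M (M + 1 - c) \<Phi>(M; c) equals E(M; a, b, c)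
  (hypergeo_moment_recurrence). Its source is the first-order recursion of f in n, which makes
  the left-hand side telescope up to terms without a denominator n + M. Differentiating r times,
  where the factor M + 1 - c that is linear in c contributes the term with r - 1, gives a
  first-order recurrence in m (harmonic_moment_step), and the closed form is its solution. That E
  may be differentiated in c at all is a consequence of the recurrence, which expresses it through \<Phi>
  near c0.

  It remains to identify E, and the series that it stands for need not converge on the boundary
  of the unit disc.
  For \<epsilon> = 1 the divergent parts are combined before summation, into the series with lower
  parameter c + 1, which converges; Gauss's summation theorem then yields the Gamma quotient.
  For \<epsilon> = -1 the recurrence is proved inside the disc and carried to -1 along the negative
  radius. The boundary values on the right are those of the continuation to the cut plane,
  so that this continuation has to be shown to exist (hypergeo_continuation_exists): composed
  with the Koebe map w \<mapsto> -4 w / (1 - w)^2 of the unit disc onto the cut plane, the Gauss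
  series becomes a power series with a linear recurrence whose coefficients grow
  subexponentially.\<close>

section \<open>Growth of the hypergeometric coefficients\<close>

definition hypergeo_coeff :: "complex \<Rightarrow> complex \<Rightarrow> complex \<Rightarrow> nat \<Rightarrow> complex" where
  "hypergeo_coeff a b c n = pochhammer a n * pochhammer b n / (pochhammer c n * fact n)"

lemma hypergeo_coeff_0 [simp]: "hypergeo_coeff a b c 0 = 1"
  by (simp add: hypergeo_coeff_def)

lemma add_of_nat_nonzero: "c + of_nat n \<noteq> 0" if "c \<notin> \<int>\<^sub>\<le>\<^sub>0" for c :: complex
  using that by (metis add_eq_0_iff minus_of_nat_in_nonpos_Ints add.commute)

lemma pochhammer_nonzero: "pochhammer c n \<noteq> 0" if "c \<notin> \<int>\<^sub>\<le>\<^sub>0" for c :: complex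
  using that by (auto simp: pochhammer_eq_0_iff)

lemma add_one_notin_nonpos_Ints: "c + 1 \<notin> \<int>\<^sub>\<le>\<^sub>0" if "c \<notin> \<int>\<^sub>\<le>\<^sub>0" for c :: complex
  using that plus_one_in_nonpos_Ints_imp by blast

lemma hypergeo_coeff_Suc:
  "hypergeo_coeff a b c (Suc n) =
     hypergeo_coeff a b c n * ((a + of_nat n) * (b + of_nat n)) / ((c + of_nat n) * of_nat (Suc n))"
  by (simp add: hypergeo_coeff_def pochhammer_Suc divide_simps del: of_nat_Suc)

lemma hypergeo_coeff_shift:
  assumes "c \<notin> \<int>\<^sub>\<le>\<^sub>0"
  shows "hypergeo_coeff a b (c + 1) n = hypergeo_coeff a b c n * c / (c + of_nat n)"
proof -
  have nz: "pochhammer c n \<noteq> 0" "c + of_nat n \<noteq> 0" "c \<noteq> 0" "pochhammer (c + 1) n \<noteq> 0"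
    using assms add_of_nat_nonzero[OF assms, of n] pochhammer_nonzero[OF assms]
      pochhammer_nonzero[OF add_one_notin_nonpos_Ints[OF assms]] by auto
  have "c * pochhammer (c + 1) n = pochhammer c n * (c + of_nat n)"
    using pochhammer_rec[of c n] pochhammer_Suc[of c n] by simp
  hence "pochhammer (c + 1) n = pochhammer c n * (c + of_nat n) / c"
    using nz by (simp add: nonzero_eq_divide_eq mult.commute)
  thus ?thesis
    using nz by (simp add: hypergeo_coeff_def)
qed

text \<open>Euler's limit formula for 1 / Gamma: its approximants form a convergent, hence bounded, sequence,
  and they are the quotients of the two sides.\<close>

lemma norm_pochhammer_le:
  fixes z :: complex
  obtains K where "\<And>n. n \<ge> 1 \<Longrightarrow> norm (pochhammer z (Suc n)) \<le> K * (fact n * of_nat n powr Re z)"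
proof -
  have "Bseq (rGamma_series z)"
    by (rule convergent_imp_Bseq) (use rGamma_series_LIMSEQ in \<open>auto simp: convergent_def\<close>)
  then obtain K where K: "\<And>n. norm (rGamma_series z n) \<le> K"
    by (auto simp: Bseq_def)
  show thesis
  proof (rule that[of K])
    fix n :: nat assume n: "n \<ge> 1"
    have "norm (exp (z * of_real (ln (of_nat n)))) = of_nat n powr Re z"
      using n by (simp add: powr_def mult.commute)
    hence "norm (rGamma_series z n) = norm (pochhammer z (Suc n)) / (fact n * of_nat n powr Re z)"
      by (simp add: rGamma_series_def norm_divide norm_mult)
    with K[of n] n show "norm (pochhammer z (Suc n)) \<le> K * (fact n * of_nat n powr Re z)"
      by (simp add: pos_divide_le_eq)
  qed
qed

lemma norm_pochhammer_ge:
  fixes z :: complex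
  assumes "z \<notin> \<int>\<^sub>\<le>\<^sub>0"
  obtains K where "K > 0"
    and "\<And>n. n \<ge> 1 \<Longrightarrow> fact n * of_nat n powr Re z \<le> K * norm (pochhammer z (Suc n))"
proof -
  have "Bseq (Gamma_series z)"
    by (rule convergent_imp_Bseq) (use Gamma_series_LIMSEQ in \<open>auto simp: convergent_def\<close>)
  then obtain K where K: "K > 0" "\<And>n. norm (Gamma_series z n) \<le> K"
    by (auto simp: Bseq_def)
  show thesis
  proof (rule that[of K])
    fix n :: nat assume n: "n \<ge> 1"
    have "norm (exp (z * of_real (ln (of_nat n)))) = of_nat n powr Re z"
      using n by (simp add: powr_def mult.commute)
    hence eq: "norm (Gamma_series z n) = fact n * of_nat n powr Re z / norm (pochhammer z (Suc n))"
      by (simp add: Gamma_series_def norm_divide norm_mult)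
    have "norm (pochhammer z (Suc n)) > 0"
      using assms by (auto simp: pochhammer_eq_0_iff)
    with K(2)[of n] show "fact n * of_nat n powr Re z \<le> K * norm (pochhammer z (Suc n))"
      unfolding eq by (simp add: pos_divide_le_eq)
  qed (use K in auto)
qed

text \<open>The coefficient has at most the order of n to the power Re (a + b - c) - 1. The index is shifted because the limit
  formula for Gamma involves the symbol of length n + 1 and n raised to the power z.\<close>

lemma norm_hypergeo_coeff_le:
  assumes "c \<notin> \<int>\<^sub>\<le>\<^sub>0"
  obtains K where "K \<ge> 0"
    and "\<And>n. n \<ge> 1 \<Longrightarrow> norm (hypergeo_coeff a b c (Suc n)) \<le> K * of_nat n powr (Re (a + b - c) - 1)"
proof -
  obtain A where A: "\<And>n. n \<ge> 1 \<Longrightarrow> norm (pochhammer a (Suc n)) \<le> A * (fact n * of_nat n powr Re a)"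
    using norm_pochhammer_le by blast
  obtain B where B: "\<And>n. n \<ge> 1 \<Longrightarrow> norm (pochhammer b (Suc n)) \<le> B * (fact n * of_nat n powr Re b)"
    using norm_pochhammer_le by blast
  obtain C where C: "C > 0" "\<And>n. n \<ge> 1 \<Longrightarrow> fact n * of_nat n powr Re c \<le> C * norm (pochhammer c (Suc n))"
    using norm_pochhammer_ge[OF assms] by blast
  have A0: "A \<ge> 0" and B0: "B \<ge> 0"
    using order_trans[OF norm_ge_zero A[of 1]] order_trans[OF norm_ge_zero B[of 1]] by simp_all
  show thesis
  proof (rule that[of "A * B * C"])
    fix n :: nat assume n: "n \<ge> 1"
    define F where "F = (fact n :: real)"
    define p where "p = real n powr Re a"
    define q where "q = real n powr Re b"
    define s where "s = real n powr Re c"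
    have pos: "F > 0" "p > 0" "q > 0" "s > 0" using n by (auto simp: F_def p_def q_def s_def)
    have c0: "norm (pochhammer c (Suc n)) > 0"
      using assms by (auto simp: pochhammer_eq_0_iff)
    have inv: "1 / norm (pochhammer c (Suc n)) \<le> C / (F * s)"
      using C(2)[OF n] pos c0 by (simp add: F_def s_def field_simps)
    have "norm (hypergeo_coeff a b c (Suc n)) =
      norm (pochhammer a (Suc n)) * norm (pochhammer b (Suc n)) * (1 / norm (pochhammer c (Suc n))) / fact (Suc n)"
      by (simp add: hypergeo_coeff_def norm_mult norm_divide del: of_nat_Suc)
    also have "\<dots> \<le> (A * (F * p)) * (B * (F * q)) * (C / (F * s)) / fact (Suc n)"
      using A[OF n] B[OF n] inv pos A0 B0 C(1)
      by (intro divide_right_mono mult_mono) (auto simp: F_def p_def q_def)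
    also have "\<dots> = A * B * C * (p * q / (s * (real n + 1)))"
    proof -
      have "(fact (Suc n) :: real) = (real n + 1) * F" by (simp add: F_def algebra_simps)
      thus ?thesis using pos by (simp add: divide_simps)
    qed
    also have "\<dots> \<le> A * B * C * (p * q / (s * real n))"
      using pos n A0 B0 C(1) by (intro mult_left_mono divide_left_mono) auto
    also have "p * q / (s * real n) = of_nat n powr (Re (a + b - c) - 1)"
      using n by (simp add: p_def q_def s_def powr_diff powr_add)
    finally show "norm (hypergeo_coeff a b c (Suc n)) \<le> A * B * C * of_nat n powr (Re (a + b - c) - 1)" .
  qed (use A0 B0 C in auto)
qed

lemma hypergeo_coeff_summable:
  assumes "c \<notin> \<int>\<^sub>\<le>\<^sub>0" and "Re (c - a - b) > 0"
  shows "summable (\<lambda>n. norm (hypergeo_coeff a b c n))"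
proof -
  obtain K where K: "K \<ge> 0"
    "\<And>n. n \<ge> 1 \<Longrightarrow> norm (hypergeo_coeff a b c (Suc n)) \<le> K * of_nat n powr (Re (a + b - c) - 1)"
    using norm_hypergeo_coeff_le[OF assms(1)] by blast
  have "summable (\<lambda>n. norm (hypergeo_coeff a b c (Suc n)))"
  proof (rule summable_comparison_test_ev)
    show "\<forall>\<^sub>F n in sequentially. norm (norm (hypergeo_coeff a b c (Suc n))) \<le>
        K * of_nat n powr (Re (a + b - c) - 1)"
      using K(2) by (auto simp: eventually_sequentially)
    show "summable (\<lambda>n. K * real n powr (Re (a + b - c) - 1))"
      using assms(2) by (intro summable_mult) (simp add: summable_real_powr_iff)
  qed
  thus ?thesis by (subst (asm) summable_Suc_iff)
qed

text \<open>The denominator n + s of a moment gains one power of n over the plain series, which moves the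
  domain of convergence from Re (c - a - b) > 0 to Re (c - a - b) > -1.\<close>

lemma hypergeo_coeff_over_nat_summable:
  assumes "c \<notin> \<int>\<^sub>\<le>\<^sub>0" and "Re (c - a - b) > -1"
  shows "summable (\<lambda>n. norm (hypergeo_coeff a b c n) / of_nat (Suc n))"
proof -
  obtain K where K: "K \<ge> 0"
    "\<And>n. n \<ge> 1 \<Longrightarrow> norm (hypergeo_coeff a b c (Suc n)) \<le> K * of_nat n powr (Re (a + b - c) - 1)"
    using norm_hypergeo_coeff_le[OF assms(1)] by blast
  have "summable (\<lambda>n. norm (hypergeo_coeff a b c (Suc n)) / of_nat (Suc (Suc n)))"
  proof (rule summable_comparison_test_ev)
    have "norm (norm (hypergeo_coeff a b c (Suc n)) / of_nat (Suc (Suc n))) \<le>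
        K * of_nat n powr (Re (a + b - c) - 2)" if n: "n \<ge> 1" for n
    proof -
      have "norm (hypergeo_coeff a b c (Suc n)) / of_nat (Suc (Suc n)) \<le>
              K * of_nat n powr (Re (a + b - c) - 1) / of_nat n"
        using K(1) K(2)[OF n] n by (intro frac_le) auto
      also have "\<dots> = K * of_nat n powr (Re (a + b - c) - 1 - 1)"
        using n powr_diff[of "real n" "Re (a + b - c) - 1" 1] by simp
      finally show ?thesis by (simp add: algebra_simps)
    qed
    thus "\<forall>\<^sub>F n in sequentially. norm (norm (hypergeo_coeff a b c (Suc n)) / of_nat (Suc (Suc n))) \<le>
        K * of_nat n powr (Re (a + b - c) - 2)"
      by (auto simp: eventually_sequentially)
    show "summable (\<lambda>n. K * real n powr (Re (a + b - c) - 2))"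
      using assms(2) by (intro summable_mult) (simp add: summable_real_powr_iff)
  qed
  thus ?thesis by (subst (asm) summable_Suc_iff)
qed

lemma hypergeo_coeff_tendsto_0:
  assumes "c \<notin> \<int>\<^sub>\<le>\<^sub>0" and "Re (c - a - b) > -1"
  shows "hypergeo_coeff a b c \<longlonglongrightarrow> 0"
proof -
  obtain K where K: "K \<ge> 0"
    "\<And>n. n \<ge> 1 \<Longrightarrow> norm (hypergeo_coeff a b c (Suc n)) \<le> K * of_nat n powr (Re (a + b - c) - 1)"
    using norm_hypergeo_coeff_le[OF assms(1)] by blast
  have "(\<lambda>n. real n powr (Re (a + b - c) - 1)) \<longlonglongrightarrow> 0"
    by (rule tendsto_neg_powr) (use assms(2) in \<open>auto intro: filterlim_real_sequentially\<close>)
  hence lim: "(\<lambda>n. K * real n powr (Re (a + b - c) - 1)) \<longlonglongrightarrow> 0"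
    by (rule tendsto_mult_right_zero)
  have "(\<lambda>n. hypergeo_coeff a b c (Suc n)) \<longlonglongrightarrow> 0"
    by (rule Lim_null_comparison[OF _ lim]) (use K in \<open>auto simp: eventually_sequentially\<close>)
  thus ?thesis by (rule LIMSEQ_imp_Suc)
qed

text \<open>Uniformity in c is reduced to one real number x to the left of the disc: once x + n is
  non-negative, |c + n| is at least Re c + n, hence at least x + n, so that all later factors of
  the symbol at x are dominated by those at c. The finitely many factors before are handled by compactness.\<close>

lemma pochhammer_locally_bounded_below:
  assumes c0: "c0 \<notin> \<int>\<^sub>\<le>\<^sub>0" and x: "x < Re c0"
  obtains \<delta> K where "\<delta> > 0" and "\<And>c. c \<in> cball c0 \<delta> \<Longrightarrow> c \<notin> \<int>\<^sub>\<le>\<^sub>0"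
    and "\<And>c n. c \<in> cball c0 \<delta> \<Longrightarrow> norm (pochhammer (of_real x) n :: complex) \<le> K * norm (pochhammer c n)"
proof -
  have "open (- (\<int>\<^sub>\<le>\<^sub>0 :: complex set))"
    by (intro open_Compl closed_nonpos_Ints)
  then obtain d where d: "d > 0" "cball c0 d \<subseteq> - \<int>\<^sub>\<le>\<^sub>0"
    using c0 open_contains_cball by blast
  define \<delta> where "\<delta> = min d (Re c0 - x)"
  have \<delta>: "\<delta> > 0" "\<And>c. c \<in> cball c0 \<delta> \<Longrightarrow> c \<notin> \<int>\<^sub>\<le>\<^sub>0"
    using d x by (auto simp: \<delta>_def)
  have Re: "Re c \<ge> x" if "c \<in> cball c0 \<delta>" for c
  proof -
    have "Re (c0 - c) \<le> norm (c0 - c)" by (rule complex_Re_le_cmod)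
    also have "\<dots> \<le> \<delta>" using that by (simp add: dist_norm)
    finally show ?thesis by (simp add: \<delta>_def)
  qed
  define N where "N = nat \<lceil>\<bar>x\<bar>\<rceil>"
  have N: "x + of_nat N \<ge> 0" unfolding N_def by linarith
  define g where "g = (\<lambda>n c. norm (pochhammer (of_real x) n / pochhammer c n :: complex))"
  have "\<exists>B. \<forall>c\<in>cball c0 \<delta>. g n c \<le> B" for n
  proof -
    have "continuous_on (cball c0 \<delta>) (g n)"
      unfolding g_def using \<delta>(2) by (auto intro!: continuous_intros simp: pochhammer_nonzero)
    hence "bounded (g n ` cball c0 \<delta>)"
      by (intro compact_imp_bounded compact_continuous_image) auto
    thus ?thesis by (auto simp: bounded_iff) (meson abs_le_D1)
  qed
  then obtain B where B: "\<And>n c. c \<in> cball c0 \<delta> \<Longrightarrow> g n c \<le> B n" by metis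
  have B0: "B n \<ge> 0" for n
    using order_trans[OF _ B[of c0 n]] \<delta>(1) by (simp add: g_def)
  define K where "K = (\<Sum>n\<le>N. B n)"
  have BK: "B n \<le> K" if "n \<le> N" for n
    unfolding K_def using that B0 by (intro member_le_sum) auto
  have le: "norm (pochhammer (of_real x) n :: complex) \<le> K * norm (pochhammer c n)"
    if c: "c \<in> cball c0 \<delta>" and n: "n \<le> N" for c n
  proof -
    have "pochhammer c n \<noteq> 0" using \<delta>(2)[OF c] by (auto simp: pochhammer_eq_0_iff)
    thus ?thesis using order_trans[OF B[OF c, of n] BK[OF n]]
      by (simp add: g_def norm_divide field_simps)
  qed
  have ge: "norm (pochhammer (of_real x) n :: complex) \<le> K * norm (pochhammer c n)"
    if c: "c \<in> cball c0 \<delta>" and n: "N \<le> n" for c n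
    using n
  proof (induction n rule: dec_induct)
    case base
    show ?case using le[OF c] by simp
  next
    case (step n)
    have "norm (of_real x + of_nat n :: complex) = x + real n"
      using N step.hyps by (metis abs_of_nonneg add_left_mono norm_of_real of_nat_le_iff of_real_add of_real_of_nat_eq order_trans)
    also have "\<dots> \<le> Re (c + of_nat n)" using Re[OF c] by simp
    also have "\<dots> \<le> norm (c + of_nat n)" by (rule complex_Re_le_cmod)
    finally have "norm (of_real x + of_nat n :: complex) \<le> norm (c + of_nat n)" .
    thus ?case
      using mult_mono[OF step.IH] order_trans[OF norm_ge_zero step.IH]
      by (simp add: pochhammer_Suc norm_mult mult.assoc)
  qed
  have "norm (pochhammer (of_real x) n :: complex) \<le> K * norm (pochhammer c n)"
    if "c \<in> cball c0 \<delta>" for c n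
    using le[OF that] ge[OF that] nat_le_linear by blast
  with \<delta> show thesis by (rule that)
qed

lemma exists_noninteger_between:
  fixes l u :: real
  assumes "l < u"
  obtains x where "l < x" "x < u" "x \<notin> \<int>"
proof (cases "(l + u) / 2 \<in> \<int>")
  case False
  thus ?thesis using assms that[of "(l + u) / 2"] by (auto simp: field_simps)
next
  case True
  then obtain k :: int where k: "(l + u) / 2 = of_int k" by (auto elim: Ints_cases)
  define x where "x = of_int k + min (u - of_int k) 1 / 2"
  have "of_int k < x" "x < of_int k + 1" "x < u" "l < x"
    using assms k by (auto simp: x_def min_def field_simps)
  moreover from this have "x \<notin> \<int>"
    by (metis Ints_cases of_int_less_iff of_int_1 of_int_add zle_add1_eq_le not_less)
  ultimately show ?thesis using that by blast
qed

text \<open>A comparison with the coefficients at a real lower parameter x slightly to the left of c0, where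
  the weighted series still converges. This is what allows differentiation under the
  sum. The number x must not be an integer, because the symbol at x has to be nonzero.\<close>

lemma hypergeo_coeff_local_majorant:
  assumes c0: "c0 \<notin> \<int>\<^sub>\<le>\<^sub>0" and re: "Re (c0 - a - b) > -1"
  obtains \<delta> M where "\<delta> > 0" and "summable (\<lambda>n. M n / of_nat (Suc n))"
    and "\<And>c. c \<in> cball c0 \<delta> \<Longrightarrow> c \<notin> \<int>\<^sub>\<le>\<^sub>0"
    and "\<And>c n. c \<in> cball c0 \<delta> \<Longrightarrow> norm (hypergeo_coeff a b c n) \<le> M n"
proof -
  have "Re a + Re b - 1 < Re c0" using re by simp
  then obtain x where x: "Re a + Re b - 1 < x" "x < Re c0" "x \<notin> \<int>"
    using exists_noninteger_between by blast
  obtain \<delta> K where \<delta>: "\<delta> > 0" "\<And>c. c \<in> cball c0 \<delta> \<Longrightarrow> c \<notin> \<int>\<^sub>\<le>\<^sub>0"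
    and K: "\<And>c n. c \<in> cball c0 \<delta> \<Longrightarrow> norm (pochhammer (of_real x) n :: complex) \<le> K * norm (pochhammer c n)"
    using pochhammer_locally_bounded_below[OF c0 x(2)] by metis
  have xc: "complex_of_real x \<notin> \<int>\<^sub>\<le>\<^sub>0"
  proof
    assume "complex_of_real x \<in> \<int>\<^sub>\<le>\<^sub>0"
    then obtain k where "complex_of_real x = of_int k" by (auto elim: nonpos_Ints_cases)
    hence "x = of_int k" by (metis of_real_eq_iff of_real_of_int_eq)
    thus False using x(3) by simp
  qed
  show thesis
  proof (rule that[of \<delta> "\<lambda>n. K * norm (hypergeo_coeff a b (of_real x) n)"])
    show "\<delta> > 0" using \<delta>(1) .
    show "summable (\<lambda>n. K * norm (hypergeo_coeff a b (of_real x) n) / of_nat (Suc n))"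
      using summable_mult[OF hypergeo_coeff_over_nat_summable[OF xc, of a b], of K] x by simp
  next
    fix c assume c': "c \<in> cball c0 \<delta>"
    show "c \<notin> \<int>\<^sub>\<le>\<^sub>0" using \<delta>(2)[OF c'] .
    fix n
    have p: "norm (pochhammer c n) > 0" "norm (pochhammer (of_real x :: complex) n) > 0"
      using \<delta>(2)[OF c'] xc by (auto simp: pochhammer_eq_0_iff)
    have "1 / norm (pochhammer c n) \<le> K / norm (pochhammer (of_real x :: complex) n)"
      using K[OF c', of n] p by (simp add: field_simps)
    hence "norm (pochhammer a n) * norm (pochhammer b n) / fact n * (1 / norm (pochhammer c n)) \<le>
          norm (pochhammer a n) * norm (pochhammer b n) / fact n * (K / norm (pochhammer (of_real x :: complex) n))"
      by (intro mult_left_mono) auto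
    thus "norm (hypergeo_coeff a b c n) \<le> K * norm (hypergeo_coeff a b (of_real x) n)"
      by (simp add: hypergeo_coeff_def norm_mult norm_divide field_simps)
  qed
qed

section \<open>Gauss's summation theorem\<close>

text \<open>The numerator (c - a - b) (c + n) + (a + n) (b + n) - n (c + n) does not depend on n: it is
  (c - a) (c - b). So, up to a telescoping part, the coefficients at c are those at c + 1.\<close>

lemma hypergeo_coeff_gauss_step:
  assumes c: "c \<notin> \<int>\<^sub>\<le>\<^sub>0"
  shows "(c - a - b) * hypergeo_coeff a b c n
           + of_nat (Suc n) * hypergeo_coeff a b c (Suc n) - of_nat n * hypergeo_coeff a b c n
         = (c - a) * (c - b) / c * hypergeo_coeff a b (c + 1) n"
proof -
  define t where "t = hypergeo_coeff a b c n"
  define N where "N = (of_nat n :: complex)"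
  have nz: "c \<noteq> 0" "c + N \<noteq> 0" using add_of_nat_nonzero[OF c, of n] c by (auto simp: N_def)
  have "of_nat (Suc n) * hypergeo_coeff a b c (Suc n) = t * ((a + N) * (b + N)) / (c + N)"
    by (simp add: hypergeo_coeff_Suc t_def N_def del: of_nat_Suc)
  moreover have "(c - a) * (c - b) / c * hypergeo_coeff a b (c + 1) n = (c - a) * (c - b) * t / (c + N)"
    using nz by (simp add: hypergeo_coeff_shift[OF c] t_def N_def)
  moreover have "(c - a - b) * t + t * ((a + N) * (b + N)) / (c + N) - N * t = (c - a) * (c - b) * t / (c + N)"
    using nz by (simp add: divide_simps) (simp add: algebra_simps)
  ultimately show ?thesis by (simp add: t_def N_def)
qed

lemma nat_mult_hypergeo_coeff_tendsto_0:
  assumes c: "c \<notin> \<int>\<^sub>\<le>\<^sub>0" and re: "Re (c - a - b) > 0"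
  shows "(\<lambda>n. of_nat n * hypergeo_coeff a b c n) \<longlonglongrightarrow> 0"
proof -
  obtain K where K: "K \<ge> 0"
    "\<And>n. n \<ge> 1 \<Longrightarrow> norm (hypergeo_coeff a b c (Suc n)) \<le> K * of_nat n powr (Re (a + b - c) - 1)"
    using norm_hypergeo_coeff_le[OF c] by blast
  have "(\<lambda>n. real n powr Re (a + b - c)) \<longlonglongrightarrow> 0"
    by (rule tendsto_neg_powr) (use re in \<open>auto intro: filterlim_real_sequentially\<close>)
  hence lim: "(\<lambda>n. 2 * K * real n powr Re (a + b - c)) \<longlonglongrightarrow> 0"
    by (rule tendsto_mult_right_zero)
  have "norm (of_nat (Suc n) * hypergeo_coeff a b c (Suc n)) \<le> 2 * K * real n powr Re (a + b - c)"
    if n: "n \<ge> 1" for n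
  proof -
    have "norm (of_nat (Suc n) * hypergeo_coeff a b c (Suc n)) =
            real (Suc n) * norm (hypergeo_coeff a b c (Suc n))"
      by (simp only: norm_mult norm_of_nat)
    also have "\<dots> \<le> (2 * real n) * (K * of_nat n powr (Re (a + b - c) - 1))"
      using n K by (intro mult_mono) auto
    also have "of_nat n powr (Re (a + b - c) - 1) = of_nat n powr Re (a + b - c) / of_nat n"
      using n powr_diff[of "real n" "Re (a + b - c)" 1] by simp
    finally show ?thesis using n by simp
  qed
  hence "(\<lambda>n. of_nat (Suc n) * hypergeo_coeff a b c (Suc n)) \<longlonglongrightarrow> 0"
    by (intro Lim_null_comparison[OF _ lim]) (auto simp: eventually_sequentially)
  thus ?thesis by (rule LIMSEQ_imp_Suc)
qed

lemma gauss_sum_contiguous: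
  assumes c: "c \<notin> \<int>\<^sub>\<le>\<^sub>0" and re: "Re (c - a - b) > 0"
  shows "c * (c - a - b) * (\<Sum>n. hypergeo_coeff a b c n) =
           (c - a) * (c - b) * (\<Sum>n. hypergeo_coeff a b (c + 1) n)"
proof -
  have c1: "c + 1 \<notin> \<int>\<^sub>\<le>\<^sub>0" using add_one_notin_nonpos_Ints[OF c] .
  have s: "summable (hypergeo_coeff a b c)" "summable (hypergeo_coeff a b (c + 1))"
    using hypergeo_coeff_summable[OF c re] hypergeo_coeff_summable[OF c1, of a b] re
    by (auto intro: summable_norm_cancel)
  have "(\<lambda>n. (c - a - b) * hypergeo_coeff a b c n + (of_nat (Suc n) * hypergeo_coeff a b c (Suc n)
           - of_nat n * hypergeo_coeff a b c n)) sums
          ((c - a - b) * (\<Sum>n. hypergeo_coeff a b c n) + (0 - of_nat 0 * hypergeo_coeff a b c 0))"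
    by (intro sums_add sums_mult summable_sums s telescope_sums nat_mult_hypergeo_coeff_tendsto_0 c re)
  moreover have "(\<lambda>n. (c - a) * (c - b) / c * hypergeo_coeff a b (c + 1) n) sums
          ((c - a) * (c - b) / c * (\<Sum>n. hypergeo_coeff a b (c + 1) n))"
    by (intro sums_mult summable_sums s)
  ultimately have "(c - a - b) * (\<Sum>n. hypergeo_coeff a b c n) =
      (c - a) * (c - b) / c * (\<Sum>n. hypergeo_coeff a b (c + 1) n)"
    using hypergeo_coeff_gauss_step[OF c, of a b] by (simp add: sums_iff add_diff_eq)
  moreover have "c \<noteq> 0" using c by auto
  ultimately show ?thesis
    by (simp only: mult.assoc times_divide_eq_left nonzero_mult_div_cancel_left) simp
qed

lemma add_of_nat_notin_nonpos_Ints: "c + of_nat k \<notin> \<int>\<^sub>\<le>\<^sub>0" if "c \<notin> \<int>\<^sub>\<le>\<^sub>0" for c :: complex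
  using that by (induction k) (auto dest: add_one_notin_nonpos_Ints simp: add_ac)

text \<open>Contiguity moves c to the right, where all terms but the first become small.\<close>

lemma gauss_sum_iterated:
  assumes c: "c \<notin> \<int>\<^sub>\<le>\<^sub>0" and re: "Re (c - a - b) > 0"
  shows "pochhammer c k * pochhammer (c - a - b) k * (\<Sum>n. hypergeo_coeff a b c n) =
           pochhammer (c - a) k * pochhammer (c - b) k * (\<Sum>n. hypergeo_coeff a b (c + of_nat k) n)"
proof (induction k)
  case (Suc k)
  define d where "d = c + of_nat k"
  have d: "d \<notin> \<int>\<^sub>\<le>\<^sub>0" unfolding d_def by (rule add_of_nat_notin_nonpos_Ints[OF c])
  have red: "Re (d - a - b) > 0" using re by (simp add: d_def)
  have "pochhammer c (Suc k) * pochhammer (c - a - b) (Suc k) * (\<Sum>n. hypergeo_coeff a b c n) =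
          (d * (d - a - b)) *
          (pochhammer c k * pochhammer (c - a - b) k * (\<Sum>n. hypergeo_coeff a b c n))"
    by (simp add: pochhammer_Suc d_def algebra_simps)
  also have "\<dots> = pochhammer (c - a) k * pochhammer (c - b) k *
               (d * (d - a - b) * (\<Sum>n. hypergeo_coeff a b d n))"
    unfolding Suc by (simp add: d_def mult_ac)
  also have "\<dots> = pochhammer (c - a) k * pochhammer (c - b) k *
               ((d - a) * (d - b) * (\<Sum>n. hypergeo_coeff a b (d + 1) n))"
    by (simp only: gauss_sum_contiguous[OF d red])
  also have "\<dots> = pochhammer (c - a) (Suc k) * pochhammer (c - b) (Suc k) *
               (\<Sum>n. hypergeo_coeff a b (c + of_nat (Suc k)) n)"
    by (simp add: pochhammer_Suc d_def algebra_simps)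
  finally show ?case .
qed simp

text \<open>Each term with n > 0 tends to 0 as the lower parameter goes to infinity. The coefficients at a
  large real x, which bounds the real parts of all later parameters from below, dominate the
  series, so that limit and sum may be exchanged.\<close>

lemma gauss_sum_shift_tendsto_1:
  assumes c: "c \<notin> \<int>\<^sub>\<le>\<^sub>0"
  shows "(\<lambda>k. \<Sum>n. hypergeo_coeff a b (c + of_nat k) n) \<longlonglongrightarrow> 1"
proof -
  define N where "N = nat \<lceil>\<bar>Re c\<bar> + \<bar>Re a\<bar> + \<bar>Re b\<bar> + 1\<rceil>"
  define x where "x = Re c + of_nat N"
  have x: "x > 0" "Re (of_real x - a - b) > 0" unfolding x_def N_def by (simp; linarith)+
  have xn: "complex_of_real x \<notin> \<int>\<^sub>\<le>\<^sub>0"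
    using x(1) by (auto elim!: nonpos_Ints_cases simp: complex_eq_iff)
  have bound: "norm (hypergeo_coeff a b (c + of_nat k) n) \<le> norm (hypergeo_coeff a b (of_real x) n)"
    if k: "k \<ge> N" for k n
  proof -
    have step: "norm (of_real x + of_nat j :: complex) \<le> norm (c + of_nat k + of_nat j)" for j
    proof -
      have "norm (of_real x + of_nat j :: complex) = x + of_nat j"
        using x(1) by (metis abs_of_nonneg add_nonneg_nonneg less_imp_le norm_of_real of_nat_0_le_iff of_real_add of_real_of_nat_eq)
      also have "\<dots> \<le> Re (c + of_nat k + of_nat j)" using k by (simp add: x_def)
      also have "\<dots> \<le> norm (c + of_nat k + of_nat j)" by (rule complex_Re_le_cmod)
      finally show ?thesis .
    qed
    have "norm (pochhammer (of_real x :: complex) n) \<le> norm (pochhammer (c + of_nat k) n)"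
      unfolding pochhammer_prod prod_norm[symmetric] by (intro prod_mono) (use step in auto)
    moreover have "pochhammer (of_real x :: complex) n \<noteq> 0" using pochhammer_nonzero[OF xn] .
    ultimately show ?thesis
      by (auto simp: hypergeo_coeff_def norm_mult norm_divide intro!: divide_left_mono mult_pos_pos)
  qed
  have lim: "(\<lambda>k. hypergeo_coeff a b (c + of_nat k) n) \<longlonglongrightarrow> (if n = 0 then 1 else 0)" for n
  proof (induction n)
    case (Suc n)
    have inf: "filterlim (\<lambda>k. c + of_nat k + of_nat n) at_infinity sequentially"
      by (intro tendsto_add_filterlim_at_infinity'[OF _ tendsto_const]
                tendsto_add_filterlim_at_infinity[OF tendsto_const] tendsto_of_nat)
    have num: "(\<lambda>k. hypergeo_coeff a b (c + of_nat k) n * ((a + of_nat n) * (b + of_nat n) / of_nat (Suc n)))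
             \<longlonglongrightarrow> (if n = 0 then 1 else 0) * ((a + of_nat n) * (b + of_nat n) / of_nat (Suc n))"
      by (rule tendsto_mult_right[OF Suc])
    have "(\<lambda>k. hypergeo_coeff a b (c + of_nat k) n * ((a + of_nat n) * (b + of_nat n) / of_nat (Suc n))
             / (c + of_nat k + of_nat n)) \<longlonglongrightarrow> 0"
      by (rule tendsto_divide_0[OF num inf])
    thus ?case by (simp add: hypergeo_coeff_Suc mult_ac del: of_nat_Suc)
  qed simp
  have "(\<lambda>k. \<Sum>n. hypergeo_coeff a b (c + of_nat k) n) \<longlonglongrightarrow> (\<Sum>n. if n = 0 then 1 else 0)"
  proof (rule tannerys_theorem[THEN conjunct2, THEN conjunct2])
    show "summable (\<lambda>n. norm (hypergeo_coeff a b (of_real x) n))"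
      by (rule hypergeo_coeff_summable[OF xn x(2)])
    show "\<forall>\<^sub>F (n, k) in at_top \<times>\<^sub>F sequentially.
        norm (hypergeo_coeff a b (c + of_nat k) n) \<le> norm (hypergeo_coeff a b (of_real x) n)"
      unfolding eventually_prod_filter
      by (intro exI[of _ "\<lambda>_. True"] exI[of _ "\<lambda>k. k \<ge> N"]) (use bound in auto)
  qed (use lim in auto)
  thus ?thesis using suminf_finite[of "{0::nat}" "\<lambda>n. if n = 0 then 1 else 0 :: complex"] by simp
qed

text \<open>In the iterated contiguity relation the powers of n hidden in the four Pochhammer symbols cancel,
  because c + (c - a - b) = (c - a) + (c - b). So the symbols may be replaced by the approximants
  of the reciprocal Gamma function, and the limit gives the theorem.\<close>

lemma gauss_summation:
  assumes c: "c \<notin> \<int>\<^sub>\<le>\<^sub>0" and re: "Re (c - a - b) > 0"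
  shows "(\<Sum>n. hypergeo_coeff a b c n) =
           Gamma c * Gamma (c - a - b) * rGamma (c - a) * rGamma (c - b)"
proof -
  define G where "G = (\<lambda>k. \<Sum>n. hypergeo_coeff a b (c + of_nat k) n)"
  define S where "S = (\<Sum>n. hypergeo_coeff a b c n)"
  have eq: "rGamma_series c n * rGamma_series (c - a - b) n * S =
              rGamma_series (c - a) n * rGamma_series (c - b) n * G (Suc n)" for n
  proof -
    define l where "l = complex_of_real (ln (real n))"
    have e: "exp (c * l) * exp ((c - a - b) * l) = exp ((c - a) * l) * exp ((c - b) * l)"
      by (simp add: exp_add[symmetric] algebra_simps)
    have "rGamma_series c n * rGamma_series (c - a - b) n * S =
        (pochhammer c (Suc n) * pochhammer (c - a - b) (Suc n) * S) /
          (fact n * fact n * (exp (c * l) * exp ((c - a - b) * l)))"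
      by (simp add: rGamma_series_def l_def mult_ac)
    also have "\<dots> = (pochhammer (c - a) (Suc n) * pochhammer (c - b) (Suc n) * G (Suc n)) /
          (fact n * fact n * (exp ((c - a) * l) * exp ((c - b) * l)))"
      using gauss_sum_iterated[OF c re, of "Suc n"] unfolding e S_def G_def by (simp del: of_nat_Suc)
    also have "\<dots> = rGamma_series (c - a) n * rGamma_series (c - b) n * G (Suc n)"
      by (simp add: rGamma_series_def l_def mult_ac)
    finally show ?thesis .
  qed
  have "(\<lambda>n. rGamma_series c n * rGamma_series (c - a - b) n * S)
           \<longlonglongrightarrow> rGamma c * rGamma (c - a - b) * S"
    by (intro tendsto_intros)
  moreover have "(\<lambda>n. rGamma_series (c - a) n * rGamma_series (c - b) n * G (Suc n))
           \<longlonglongrightarrow> rGamma (c - a) * rGamma (c - b) * 1"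
    unfolding G_def
    by (intro tendsto_intros LIMSEQ_Suc gauss_sum_shift_tendsto_1[OF c])
  ultimately have main: "rGamma c * rGamma (c - a - b) * S = rGamma (c - a) * rGamma (c - b)"
    using LIMSEQ_unique by (simp only: eq mult_1_right) 
  have "c - a - b \<notin> \<int>\<^sub>\<le>\<^sub>0"
  proof
    assume "c - a - b \<in> \<int>\<^sub>\<le>\<^sub>0"
    then obtain k where "c - a - b = of_int k" "k \<le> 0" by (rule nonpos_Ints_cases)
    thus False using re by simp
  qed
  hence "Gamma c * rGamma c = 1" "Gamma (c - a - b) * rGamma (c - a - b) = 1"
    using c by (auto simp: rGamma_inverse_Gamma Gamma_eq_zero_iff)
  hence "S = (Gamma c * rGamma c) * (Gamma (c - a - b) * rGamma (c - a - b)) * S"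
    by simp
  also have "\<dots> = Gamma c * Gamma (c - a - b) * (rGamma c * rGamma (c - a - b) * S)"
    by (simp only: mult_ac)
  also note main
  finally show ?thesis unfolding S_def by (simp only: mult.assoc)
qed

text \<open>The Gauss sum at c + 1 converges on the whole half plane Re (c - a - b) > -1, unlike the one at
  c, and this form of E is the one that the moment recurrence produces.\<close>

lemma E_plus_eq_gauss_sum:
  assumes c: "c \<notin> \<int>\<^sub>\<le>\<^sub>0" and re: "Re (c - a - b) > -1"
  shows "E_plus M a b c = (c - a) * (c - b) / c * (\<Sum>n. hypergeo_coeff a b (c + 1) n)"
proof -
  have "(\<Sum>n. hypergeo_coeff a b (c + 1) n) =
      Gamma (c + 1) * Gamma (c - a - b + 1) * rGamma (c - a + 1) * rGamma (c - b + 1)"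
    using gauss_summation[OF add_one_notin_nonpos_Ints[OF c], of a b] re
    by (simp add: algebra_simps)
  also have "Gamma (c + 1) = c * Gamma c" using c by (intro Gamma_plus1) auto
  finally have "(c - a) * (c - b) / c * (\<Sum>n. hypergeo_coeff a b (c + 1) n)
    = Gamma c * Gamma (c - a - b + 1) * ((c - a) * rGamma (c - a + 1)) * ((c - b) * rGamma (c - b + 1))"
    using c by auto
  thus ?thesis by (simp add: E_plus_def rGamma_plus1)
qed

section \<open>The moment recurrence at argument 1\<close>

lemma inverse_of_nat_add_le:
  fixes M :: complex
  assumes "Re M > 0"
  obtains B where "B > 0" and "\<And>n. norm (1 / (of_nat n + M)) \<le> B / of_nat (Suc n)"
proof -
  define \<kappa> where "\<kappa> = min 1 (Re M)"
  have \<kappa>: "\<kappa> > 0" using assms by (simp add: \<kappa>_def)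
  show thesis
  proof (rule that[of "1 / \<kappa>"])
    fix n :: nat
    have "\<kappa> * of_nat (Suc n) = \<kappa> * real n + \<kappa>" by (simp add: algebra_simps)
    also have "\<dots> \<le> 1 * real n + Re M" by (intro add_mono mult_right_mono) (auto simp: \<kappa>_def)
    also have "\<dots> = Re (of_nat n + M)" by simp
    also have "\<dots> \<le> norm (of_nat n + M)" by (rule complex_Re_le_cmod)
    finally have "\<kappa> * of_nat (Suc n) \<le> norm (of_nat n + M)" .
    thus "norm (1 / (of_nat n + M)) \<le> 1 / \<kappa> / of_nat (Suc n)"
      using \<kappa> by (simp add: norm_divide divide_simps mult.commute del: of_nat_Suc)
  qed (use \<kappa> in simp)
qed

lemma of_nat_add_nonzero: "of_nat n + M \<noteq> 0" if "Re M > 0" for M :: complex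
proof
  assume "of_nat n + M = 0"
  hence "Re (of_nat n + M) = 0" by simp
  thus False using that by simp
qed

lemma hypergeo_moment_summable:
  assumes c: "c \<notin> \<int>\<^sub>\<le>\<^sub>0" and re: "Re (c - a - b) > -1" and M: "Re M > 0"
  shows "summable (\<lambda>n. norm (hypergeo_coeff a b c n / (of_nat n + M)))"
proof -
  obtain B where B: "B > 0" "\<And>n. norm (1 / (of_nat n + M)) \<le> B / of_nat (Suc n)"
    using inverse_of_nat_add_le[OF M] by blast
  show ?thesis
  proof (rule summable_comparison_test')
    show "summable (\<lambda>n. B * (norm (hypergeo_coeff a b c n) / of_nat (Suc n)))"
      by (intro summable_mult hypergeo_coeff_over_nat_summable c re)
    show "norm (norm (hypergeo_coeff a b c n / (of_nat n + M))) \<le>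
        B * (norm (hypergeo_coeff a b c n) / of_nat (Suc n))" for n
      using mult_left_mono[OF B(2)[of n], of "norm (hypergeo_coeff a b c n)"]
      by (simp add: norm_divide mult.commute del: of_nat_Suc)
  qed
qed

text \<open>Partial fractions in n. The polynomial (n + a) (n + b) takes the value (M + 1 - a) (M + 1 - b) at
  n = -(M + 1), and n (n + c - 1) takes the value M (M + 1 - c) at n = -M; the recursion of the
  coefficients connects the two with a shift of n by one. This would telescope the sequence
  n (n + c - 1) / (n + M) times the coefficient, which need not be bounded. In v its leading part,
  n times the coefficient, has been subtracted, and by the contiguity step above this turns the
  remainder into the coefficients at c + 1.\<close>

lemma moment_telescoping_step:
  fixes a b c M :: complex
  assumes c: "c \<notin> \<int>\<^sub>\<le>\<^sub>0" and M: "Re M > 0"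
  defines "v \<equiv> \<lambda>n. hypergeo_coeff a b c n * (of_nat n / (of_nat n + M)) * (c - 1 - M)"
  shows "(M + 1 - a) * (M + 1 - b) * (hypergeo_coeff a b c n / (of_nat n + (M + 1)))
           - M * (M + 1 - c) * (hypergeo_coeff a b c n / (of_nat n + M))
         = (c - a) * (c - b) / c * hypergeo_coeff a b (c + 1) n + (v (Suc n) - v n)"
proof -
  define t where "t = hypergeo_coeff a b c n"
  define N where "N = (of_nat n :: complex)"
  have nz: "c \<noteq> 0" "c + N \<noteq> 0" "N + M \<noteq> 0" "N + 1 + M \<noteq> 0" "N + 1 \<noteq> 0"
    using add_of_nat_nonzero[OF c, of n] c of_nat_add_nonzero[OF M, of n]
      of_nat_add_nonzero[OF M, of "Suc n"] of_nat_neq_0[of n]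
    by (auto simp: N_def add_ac)
  have vS: "v (Suc n) = t * ((a + N) * (b + N) / (c + N) * (c - 1 - M) / (N + 1 + M))"
    using nz by (simp add: v_def hypergeo_coeff_Suc t_def N_def divide_simps add_ac)
  have e1: "(M + 1 - a) * (M + 1 - b) / (N + 1 + M) =
              (a + N) * (b + N) / (N + 1 + M) - (N + a + b - M - 1)"
    using nz by (simp add: field_simps)
  have e2: "(c - a) * (c - b) / (c + N) = (a + N) * (b + N) / (c + N) + (c - a - b - N)"
    using nz by (simp add: field_simps)
  have e3: "(a + N) * (b + N) / (c + N) * (c - 1 - M) / (N + 1 + M) =
              (a + N) * (b + N) / (N + 1 + M) - (a + N) * (b + N) / (c + N)"
    using nz by (simp add: divide_simps) (simp add: algebra_simps)
  have e4: "N / (N + M) * (c - 1 - M) = (c - 1 - M) + M * (M + 1 - c) / (N + M)"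
    using nz by (simp add: field_simps)
  have main: "(M + 1 - a) * (M + 1 - b) / (N + 1 + M) - M * (M + 1 - c) / (N + M) =
          (c - a) * (c - b) / (c + N) + ((a + N) * (b + N) / (c + N) * (c - 1 - M) / (N + 1 + M)
             - N / (N + M) * (c - 1 - M))"
    unfolding e1 e2 e3 e4 by (simp add: algebra_simps)
  have factor: "p * (t / (N + (M + 1))) - q * (t / (N + M)) = t * (p / (N + 1 + M) - q / (N + M))" for p q
    by (simp add: right_diff_distrib mult.commute add_ac)
  have shift: "(c - a) * (c - b) / c * hypergeo_coeff a b (c + 1) n = t * ((c - a) * (c - b) / (c + N))"
    using nz by (simp add: hypergeo_coeff_shift[OF c] t_def N_def)
  have vn: "v n = t * (N / (N + M) * (c - 1 - M))" by (simp add: v_def t_def N_def)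
  have expand: "t * (x + (y - w)) = t * x + (t * y - t * w)" for x y w
    by (simp only: distrib_left right_diff_distrib)
  show ?thesis
    unfolding vS vn shift t_def[symmetric] N_def[symmetric] factor main by (rule expand)
qed

lemma moment_recurrence_plus:
  assumes c: "c \<notin> \<int>\<^sub>\<le>\<^sub>0" and re: "Re (c - a - b) > -1" and M: "Re M > 0"
  shows "(M + 1 - a) * (M + 1 - b) * (\<Sum>n. hypergeo_coeff a b c n / (of_nat n + (M + 1)))
           - M * (M + 1 - c) * (\<Sum>n. hypergeo_coeff a b c n / (of_nat n + M))
         = E_plus M a b c"
proof -
  define v where "v = (\<lambda>n. hypergeo_coeff a b c n * (of_nat n / (of_nat n + M)) * (c - 1 - M))"
  have frac: "(\<lambda>n. of_nat n / (of_nat n + M)) \<longlonglongrightarrow> 1"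
  proof -
    have inf: "filterlim (\<lambda>n. of_nat n + M) at_infinity sequentially"
      by (rule tendsto_add_filterlim_at_infinity'[OF tendsto_of_nat tendsto_const])
    have "(\<lambda>n. 1 - M / (of_nat n + M)) \<longlonglongrightarrow> 1 - 0"
      by (rule tendsto_diff[OF tendsto_const tendsto_divide_0[OF tendsto_const inf]])
    moreover have "1 - M / (of_nat n + M) = of_nat n / (of_nat n + M)" for n
      using of_nat_add_nonzero[OF M, of n] by (simp add: field_simps)
    ultimately show ?thesis by simp
  qed
  have "v \<longlonglongrightarrow> 0 * 1 * (c - 1 - M)"
    unfolding v_def by (rule tendsto_mult_right[OF tendsto_mult[OF hypergeo_coeff_tendsto_0[OF c re] frac]])
  hence v: "v \<longlonglongrightarrow> 0" by simp
  have s: "summable (hypergeo_coeff a b (c + 1))"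
    using hypergeo_coeff_summable[OF add_one_notin_nonpos_Ints[OF c], of a b] re
    by (auto intro: summable_norm_cancel)
  have M1: "Re (M + 1) > 0" using M by simp
  have "(\<lambda>n. (c - a) * (c - b) / c * hypergeo_coeff a b (c + 1) n + (v (Suc n) - v n)) sums
          ((c - a) * (c - b) / c * (\<Sum>n. hypergeo_coeff a b (c + 1) n) + (0 - v 0))"
    by (intro sums_add sums_mult summable_sums s telescope_sums v)
  moreover have "v 0 = 0" by (simp add: v_def)
  ultimately have "(\<lambda>n. (c - a) * (c - b) / c * hypergeo_coeff a b (c + 1) n + (v (Suc n) - v n)) sums
      E_plus M a b c"
    by (simp only: E_plus_eq_gauss_sum[OF c re] diff_zero add_0_right)
  hence "(\<lambda>n. (M + 1 - a) * (M + 1 - b) * (hypergeo_coeff a b c n / (of_nat n + (M + 1)))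
           - M * (M + 1 - c) * (hypergeo_coeff a b c n / (of_nat n + M))) sums E_plus M a b c"
    by (simp only: moment_telescoping_step[OF c M] v_def)
  moreover have "(\<lambda>n. (M + 1 - a) * (M + 1 - b) * (hypergeo_coeff a b c n / (of_nat n + (M + 1)))
           - M * (M + 1 - c) * (hypergeo_coeff a b c n / (of_nat n + M))) sums
        ((M + 1 - a) * (M + 1 - b) * (\<Sum>n. hypergeo_coeff a b c n / (of_nat n + (M + 1)))
           - M * (M + 1 - c) * (\<Sum>n. hypergeo_coeff a b c n / (of_nat n + M)))"
    by (intro sums_diff sums_mult summable_sums summable_norm_cancel[OF hypergeo_moment_summable[OF c re]] M M1)
  ultimately show ?thesis by (rule sums_unique2[symmetric])
qed

section \<open>Continuation of the hypergeometric series to the cut plane\<close>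

text \<open>The Taylor series at 0 of the Koebe map w \<mapsto> -4 w / (1 - w)^2 of the unit disc onto the cut
  plane.\<close>

definition koebe_fps :: "complex fps" where
  "koebe_fps = fps_const (-4) * fps_X * inverse ((1 - fps_X) ^ 2)"

text \<open>The Euler operator. It is used instead of the plain derivative because the hypergeometric
  equation has constant coefficients up to one factor z when written with it, and because it
  pulls back along the Koebe map to a simple multiple of itself.\<close>

abbreviation fps_theta :: "complex fps \<Rightarrow> complex fps" where
  "fps_theta G \<equiv> fps_X * fps_deriv G"

lemma koebe_fps_nth_0 [simp]: "fps_nth koebe_fps 0 = 0"
  by (simp add: koebe_fps_def)

lemma koebe_fps_mult: "koebe_fps * (1 - fps_X) ^ 2 = - 4 * fps_X"
proof -
  have "inverse ((1 - fps_X) ^ 2) * (1 - fps_X :: complex fps) ^ 2 = 1"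
    by (rule inverse_mult_eq_1) simp
  thus ?thesis by (simp add: koebe_fps_def mult.assoc fps_const_neg[symmetric] numeral_fps_const del: fps_const_neg)
qed

text \<open>The logarithmic derivative of w / (1 - w)^2 is (1 + w) / (w (1 - w)).\<close>

lemma fps_theta_koebe: "fps_theta koebe_fps * (1 - fps_X) = koebe_fps * (1 + fps_X)"
proof -
  have "fps_deriv (koebe_fps * (1 - fps_X) ^ 2) = fps_deriv (- 4 * fps_X)"
    by (simp only: koebe_fps_mult)
  hence "fps_deriv koebe_fps * (1 - fps_X) ^ 2 - 2 * koebe_fps * (1 - fps_X) = - 4"
    by (simp add: fps_deriv_power power2_eq_square algebra_simps)
  hence "fps_theta koebe_fps * (1 - fps_X) ^ 2 =
           2 * fps_X * koebe_fps * (1 - fps_X) + koebe_fps * (1 - fps_X) ^ 2"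
    unfolding koebe_fps_mult by algebra
  hence "(1 - fps_X) * (fps_theta koebe_fps * (1 - fps_X)) = (1 - fps_X) * (koebe_fps * (1 + fps_X))"
    by algebra
  moreover have "(1 - fps_X :: complex fps) \<noteq> 0"
    by (metis fps_X_neq_one eq_iff_diff_eq_0)
  ultimately show ?thesis by simp
qed

lemma fps_theta_compose_koebe:
  "fps_theta (fps_compose G koebe_fps) * (1 - fps_X) = fps_compose (fps_theta G) koebe_fps * (1 + fps_X)"
proof -
  have "fps_compose (fps_theta G) koebe_fps = koebe_fps * fps_compose (fps_deriv G) koebe_fps"
    by (simp add: fps_compose_mult_distrib)
  moreover have "fps_deriv (fps_compose G koebe_fps) = fps_compose (fps_deriv G) koebe_fps * fps_deriv koebe_fps"
    by (rule fps_compose_deriv) simp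
  ultimately show ?thesis using fps_theta_koebe
    by (metis (no_types, lifting) mult.assoc mult.commute)
qed

definition hypergeo_fps :: "complex \<Rightarrow> complex \<Rightarrow> complex \<Rightarrow> complex fps" where
  "hypergeo_fps a b c = Abs_fps (hypergeo_coeff a b c)"

text \<open>The hypergeometric differential equation: each side collects one side of the recursion
  (n + 1) (c + n) f(n + 1) = (a + n) (b + n) f(n).\<close>

lemma hypergeo_fps_ode:
  assumes c: "c \<notin> \<int>\<^sub>\<le>\<^sub>0"
  shows "fps_theta (fps_theta (hypergeo_fps a b c)) + fps_const (c - 1) * fps_theta (hypergeo_fps a b c) =
     fps_X * (fps_theta (fps_theta (hypergeo_fps a b c)) + fps_const (a + b) * fps_theta (hypergeo_fps a b c)
               + fps_const (a * b) * hypergeo_fps a b c)" (is "?l = ?r")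
proof (rule fps_ext)
  fix n show "fps_nth ?l n = fps_nth ?r n"
  proof (cases n)
    case (Suc m)
    have "c + of_nat m \<noteq> 0" by (rule add_of_nat_nonzero[OF c])
    hence "of_nat (Suc m) * (c + of_nat m) * hypergeo_coeff a b c (Suc m) =
             (a + of_nat m) * (b + of_nat m) * hypergeo_coeff a b c m"
      using of_nat_neq_0[of m] by (simp add: hypergeo_coeff_Suc del: of_nat_Suc)
    moreover have "fps_nth ?l n = of_nat (Suc m) * (c + of_nat m) * hypergeo_coeff a b c (Suc m)"
      using Suc by (simp add: hypergeo_fps_def algebra_simps)
    moreover have "fps_nth ?r n = (a + of_nat m) * (b + of_nat m) * hypergeo_coeff a b c m"
      using Suc by (cases m) (simp_all add: hypergeo_fps_def algebra_simps)
    ultimately show ?thesis by simp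
  qed simp
qed

text \<open>The equation of second order is transported as a system of first order, for the Gauss series
  H and its image K under the Euler operator, both composed with the Koebe map. In this
  form the chain rule is applied to first derivatives only. The finite
  singularities of the system apart from 0 are 1 and -1, on the unit circle, which is why the
  radius of convergence is at least 1.\<close>

context
  fixes a b c :: complex and H K :: "complex fps"
  assumes c: "c \<notin> \<int>\<^sub>\<le>\<^sub>0"
  defines "H \<equiv> fps_compose (hypergeo_fps a b c) koebe_fps"
    and "K \<equiv> fps_compose (fps_theta (hypergeo_fps a b c)) koebe_fps"
begin

lemma koebe_system_1: "fps_theta H * (1 - fps_X) = K * (1 + fps_X)"
  unfolding H_def K_def by (rule fps_theta_compose_koebe)

text \<open>The hypergeometric equation determines the second Euler derivative L only after multiplication
  by 1 minus the Koebe map; that factor is (1 + w)^2 / (1 - w)^2, so polynomial coefficients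
  suffice.\<close>

lemma koebe_system_2:
  "fps_theta K * (1 - fps_X ^ 2) =
     - fps_const (c - 1) * (1 - fps_X) ^ 2 * K - 4 * fps_X * (fps_const (a + b) * K + fps_const (a * b) * H)"
proof -
  define L where "L = fps_compose (fps_theta (fps_theta (hypergeo_fps a b c))) koebe_fps"
  have L: "fps_theta K * (1 - fps_X) = L * (1 + fps_X)"
    unfolding K_def L_def by (rule fps_theta_compose_koebe)
  have "L + fps_const (c - 1) * K = koebe_fps * (L + fps_const (a + b) * K + fps_const (a * b) * H)"
    using arg_cong[OF hypergeo_fps_ode[OF c, of a b], of "\<lambda>G. fps_compose G koebe_fps"]
    by (simp only: fps_compose_add_distrib fps_compose_mult_distrib[OF koebe_fps_nth_0]
         fps_const_compose fps_X_fps_compose_startby0[OF koebe_fps_nth_0] H_def K_def L_def)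
  with koebe_fps_mult L show ?thesis by algebra
qed

lemma koebe_recurrence_H:
  "of_nat (Suc n) * fps_nth H (Suc n) = of_nat n * fps_nth H n + fps_nth K (Suc n) + fps_nth K n"
proof -
  have "fps_nth (fps_theta H * (1 - fps_X)) (Suc n) = fps_nth (K * (1 + fps_X)) (Suc n)"
    by (simp only: koebe_system_1)
  thus ?thesis by (cases n) (simp_all add: algebra_simps)
qed

lemma koebe_recurrence_K:
  "(of_nat n + c + 1) * fps_nth K (Suc (Suc n)) =
     (of_nat n + 1 - c) * fps_nth K n + (2 * (c - 1) - 4 * (a + b)) * fps_nth K (Suc n)
       - 4 * (a * b) * fps_nth H (Suc n)"
proof -
  have "fps_theta K - fps_X * (fps_X * fps_theta K) =
     - (fps_const (c - 1) * K) + fps_X * (fps_const (2 * (c - 1)) * K) - fps_X * (fps_X * (fps_const (c - 1) * K))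
       - fps_X * (fps_const (4 * (a + b)) * K + fps_const (4 * (a * b)) * H)"
    using koebe_system_2
    by (simp add: power2_eq_square algebra_simps numeral_fps_const fps_const_mult[symmetric]
        fps_const_add[symmetric] fps_const_sub[symmetric]
        del: fps_const_mult fps_const_add fps_const_sub)
  from arg_cong[OF this, of "\<lambda>G. fps_nth G (Suc (Suc n))"] show ?thesis
    by (cases n) (simp_all add: algebra_simps)
qed

text \<open>The recurrences bound a coefficient of index n by 1 + O(1 / n) times the largest of the few
  before it, hence by q times that for n beyond some N. The constant C takes care of the
  coefficients up to N.\<close>

lemma koebe_growth:
  fixes q :: real
  assumes q: "q > 1"
  shows "\<exists>C. \<forall>n. norm (fps_nth H n) \<le> C * q ^ n"
proof -
  define B where "B = norm (2 * (c - 1) - 4 * (a + b)) + norm (4 * (a * b))"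
  obtain N :: nat where N: "of_nat N * (q - 1) > (q + 1) * (1 + norm c) + B + q"
    using reals_Archimedean3[of "q - 1"] q by fastforce
  have large: "norm (of_nat n + 1 - c) + B \<le> q * norm (of_nat n + c + 1)" "of_nat (Suc (Suc n)) * (q - 1) \<ge> q"
    if n: "n \<ge> N" for n
  proof -
    have B0: "B \<ge> 0" by (simp add: B_def)
    have "of_nat N * (q - 1) \<le> of_nat n * (q - 1)" using n q by (intro mult_right_mono) auto
    with N have N': "of_nat n * (q - 1) > (q + 1) * (1 + norm c) + B + q" by linarith
    have "norm (of_nat n + 1 - c) \<le> norm (of_nat n + 1 :: complex) + norm c" by (rule norm_triangle_ineq4)
    also have "norm (of_nat n + 1 :: complex) = real n + 1"
      by (metis norm_of_nat of_nat_Suc add.commute)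
    finally have 1: "norm (of_nat n + 1 - c) \<le> real n + 1 + norm c" .
    have "real n - norm c - 1 \<le> norm (of_nat n + c + 1)"
      using norm_triangle_ineq4[of "of_nat n + c + 1" "c + 1"] norm_triangle_ineq[of c 1] by simp
    hence "q * (real n - norm c - 1) \<le> q * norm (of_nat n + c + 1)"
      using q by (intro mult_left_mono) auto
    moreover have "real n + 1 + norm c + B \<le> q * (real n - norm c - 1)"
      using N' q by (simp add: algebra_simps)
    ultimately show "norm (of_nat n + 1 - c) + B \<le> q * norm (of_nat n + c + 1)" using 1 by linarith
    have "(q + 1) * (1 + norm c) \<ge> 0" using q by simp
    hence "real n * (q - 1) \<ge> q" using N' B0 by linarith
    moreover have "of_nat (Suc (Suc n)) * (q - 1) = real n * (q - 1) + 2 * (q - 1)"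
      by (simp add: algebra_simps)
    ultimately show "of_nat (Suc (Suc n)) * (q - 1) \<ge> q" using q by simp
  qed
  define C where "C = (\<Sum>n\<le>Suc N. norm (fps_nth H n) + norm (fps_nth K n))"
  have C0: "C \<ge> 0" unfolding C_def by (intro sum_nonneg) auto
  have "norm (fps_nth H n) \<le> C * q ^ n \<and> norm (fps_nth K n) \<le> C * q ^ n" for n
  proof (induction n rule: less_induct)
    case (less n)
    show ?case
    proof (cases "n \<le> Suc N")
      case True
      hence "norm (fps_nth H n) + norm (fps_nth K n) \<le> C"
        unfolding C_def by (intro member_le_sum) auto
      moreover have "C * 1 \<le> C * q ^ n" using C0 q by (intro mult_left_mono one_le_power) auto
      ultimately show ?thesis using norm_ge_zero[of "fps_nth H n"] norm_ge_zero[of "fps_nth K n"] by linarith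
    next
      case False
      then obtain m where m: "n = Suc (Suc m)" "m \<ge> N" by (cases n; cases "n - 1") auto
      define Q where "Q = C * q ^ Suc m"
      have Q0: "Q \<ge> 0" using C0 q by (simp add: Q_def)
      have IH: "norm (fps_nth H (Suc m)) \<le> Q" "norm (fps_nth K (Suc m)) \<le> Q" "norm (fps_nth K m) \<le> Q"
      proof -
        have "C * q ^ m \<le> C * q ^ Suc m" using C0 q by (intro mult_left_mono power_increasing) auto
        thus "norm (fps_nth K m) \<le> Q" using less.IH[of m] m by (auto simp: Q_def)
      qed (use less.IH[of "Suc m"] m in \<open>auto simp: Q_def\<close>)
      \<comment> \<open>The coefficient of K comes first, since that of H at the same index depends on it.\<close>
      have "norm (of_nat m + c + 1) * norm (fps_nth K n) =
              norm ((of_nat m + 1 - c) * fps_nth K m + (2 * (c - 1) - 4 * (a + b)) * fps_nth K (Suc m)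
                 - 4 * (a * b) * fps_nth H (Suc m))"
        unfolding m koebe_recurrence_K[symmetric] by (rule norm_mult[symmetric])
      also have "\<dots> \<le> norm (of_nat m + 1 - c) * norm (fps_nth K m)
               + norm (2 * (c - 1) - 4 * (a + b)) * norm (fps_nth K (Suc m))
               + norm (4 * (a * b)) * norm (fps_nth H (Suc m))"
        unfolding norm_mult[symmetric]
        by (intro order_trans[OF norm_triangle_ineq4] add_right_mono norm_triangle_ineq)
      also have "\<dots> \<le> norm (of_nat m + 1 - c) * Q + norm (2 * (c - 1) - 4 * (a + b)) * Q + norm (4 * (a * b)) * Q"
        using IH by (intro add_mono mult_left_mono) auto
      also have "\<dots> = (norm (of_nat m + 1 - c) + B) * Q" by (simp add: B_def algebra_simps)
      also have "\<dots> \<le> q * norm (of_nat m + c + 1) * Q"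
        using large(1)[OF m(2)] Q0 by (intro mult_right_mono) auto
      finally have "norm (of_nat m + c + 1) * norm (fps_nth K n) \<le> norm (of_nat m + c + 1) * (q * Q)"
        by (simp add: mult_ac)
      moreover have "norm (of_nat m + c + 1) > 0"
        using add_of_nat_nonzero[OF c, of "Suc m"] by (simp add: add_ac)
      ultimately have Kn: "norm (fps_nth K n) \<le> q * Q" by simp
      have "real n * norm (fps_nth H n) =
              norm (of_nat (Suc m) * fps_nth H (Suc m) + fps_nth K n + fps_nth K (Suc m))"
        unfolding m koebe_recurrence_H[symmetric] by (simp only: norm_mult norm_of_nat)
      also have "\<dots> \<le> real (Suc m) * norm (fps_nth H (Suc m)) + norm (fps_nth K n) + norm (fps_nth K (Suc m))"
        by (intro order_trans[OF norm_triangle_ineq] add_mono order_refl)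
          (simp only: norm_mult norm_of_nat order_refl)
      also have "\<dots> \<le> real (Suc m) * Q + q * Q + Q"
        using IH Kn by (intro add_mono mult_left_mono) auto
      also have "\<dots> = (real n + q) * Q" by (simp add: m algebra_simps)
      also have "\<dots> \<le> (real n * q) * Q"
        using large(2)[OF m(2)] Q0 by (intro mult_right_mono) (auto simp: m algebra_simps)
      finally have "real n * norm (fps_nth H n) \<le> real n * (q * Q)" by (simp add: mult_ac)
      hence "norm (fps_nth H n) \<le> q * Q" using m by simp
      thus ?thesis using Kn by (simp add: m Q_def mult_ac)
    qed
  qed
  thus ?thesis by blast
qed

text \<open>Given r < 1, any growth rate q > 1 with q r < 1 will do; q = 2 / (1 + r) is one.\<close>

lemma koebe_conv_radius: "fps_conv_radius H \<ge> 1"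
  unfolding fps_conv_radius_def
proof (rule conv_radius_geI_ex')
  fix r :: real assume r: "0 < r" "ereal r < 1"
  define q where "q = 2 / (1 + r)"
  have q: "q > 1" "q * r < 1" "q * r > 0" using r by (auto simp: q_def field_simps)
  obtain C where C: "\<And>n. norm (fps_nth H n) \<le> C * q ^ n"
    using koebe_growth[OF q(1)] by blast
  show "summable (\<lambda>n. fps_nth H n * of_real r ^ n)"
  proof (rule summable_comparison_test')
    show "summable (\<lambda>n. C * (q * r) ^ n)"
      by (intro summable_mult summable_geometric) (use q in auto)
    show "norm (fps_nth H n * of_real r ^ n) \<le> C * (q * r) ^ n" for n
      using mult_right_mono[OF C[of n], of "r ^ n"] r
      by (simp add: norm_mult norm_power power_mult_distrib mult_ac)
  qed
qed

end

text \<open>The inverse of the Koebe map: with s the square root of 1 - z in the right half plane,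
  1 - z = (1 + w)^2 / (1 - w)^2 is solved by w = (s - 1) / (s + 1), and Re s > 0 says |w| < 1.\<close>

definition koebe_inverse :: "complex \<Rightarrow> complex" where
  "koebe_inverse z = (csqrt (1 - z) - 1) / (csqrt (1 - z) + 1)"

lemma cut_plane_iff: "z \<in> hypergeo_cut_plane \<longleftrightarrow> 1 - z \<notin> \<real>\<^sub>\<le>\<^sub>0"
proof
  assume *: "z \<in> hypergeo_cut_plane"
  show "1 - z \<notin> \<real>\<^sub>\<le>\<^sub>0"
  proof
    assume "1 - z \<in> \<real>\<^sub>\<le>\<^sub>0"
    then obtain x where x: "1 - z = of_real x" "x \<le> 0" by (auto elim: nonpos_Reals_cases)
    have "z = 1 - (1 - z)" by simp
    also have "\<dots> = of_real (1 - x)" by (simp only: x) simp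
    finally have "z \<in> of_real ` {1..}"
      by (rule image_eqI) (use x(2) in auto)
    with * show False by (simp add: hypergeo_cut_plane_def)
  qed
qed (auto simp: hypergeo_cut_plane_def complex_nonpos_Reals_iff)

lemma hypergeo_cut_plane_open: "open hypergeo_cut_plane"
proof -
  have "hypergeo_cut_plane = (\<lambda>z. 1 - z) -` (- \<real>\<^sub>\<le>\<^sub>0)" by (auto simp: cut_plane_iff)
  moreover have "open ((\<lambda>z. 1 - z) -` (- \<real>\<^sub>\<le>\<^sub>0 :: complex set))"
    by (intro open_vimage open_Compl closed_nonpos_Reals_complex continuous_intros)
  ultimately show ?thesis by simp
qed

lemma unit_ball_subset_cut_plane: "ball 0 1 \<subseteq> hypergeo_cut_plane"
  by (auto simp: hypergeo_cut_plane_def norm_of_real)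

lemma Re_csqrt_nonneg: "Re (csqrt w) \<ge> 0"
  using csqrt_principal[of w] by linarith

lemma csqrt_plus_one_nonzero: "csqrt w + 1 \<noteq> 0"
proof
  assume "csqrt w + 1 = 0"
  hence "Re (csqrt w + 1) = 0" by (simp only: zero_complex.sel)
  thus False using Re_csqrt_nonneg[of w] by (simp only: plus_complex.sel one_complex.sel)
qed

lemma koebe_inverse_holomorphic: "koebe_inverse holomorphic_on hypergeo_cut_plane"
  unfolding koebe_inverse_def
  by (intro holomorphic_intros) (use csqrt_plus_one_nonzero in \<open>auto simp: cut_plane_iff\<close>)

lemma norm_koebe_inverse_less_1:
  assumes "z \<in> hypergeo_cut_plane"
  shows "norm (koebe_inverse z) < 1"
proof -
  define s where "s = csqrt (1 - z)"
  have "Re s \<noteq> 0"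
  proof
    assume "Re s = 0"
    hence "Re (s ^ 2) \<le> 0" "Im (s ^ 2) = 0" by (simp_all add: Re_power2 Im_power2)
    hence "1 - z \<in> \<real>\<^sub>\<le>\<^sub>0" by (simp add: s_def complex_nonpos_Reals_iff)
    thus False using assms by (simp add: cut_plane_iff)
  qed
  hence "Re s > 0" using Re_csqrt_nonneg[of "1 - z"] by (simp add: s_def)
  moreover have "norm (s + 1) ^ 2 - norm (s - 1) ^ 2 = 4 * Re s"
    unfolding cmod_power2 by (simp add: power2_eq_square algebra_simps)
  ultimately have "norm (s - 1) ^ 2 < norm (s + 1) ^ 2" by linarith
  hence "norm (s - 1) < norm (s + 1)" by (rule power_less_imp_less_base) simp
  thus ?thesis
    using csqrt_plus_one_nonzero[of "1 - z"] by (simp add: koebe_inverse_def s_def norm_divide)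
qed

lemma koebe_inverse: "-4 * koebe_inverse z * inverse ((1 - koebe_inverse z) ^ 2) = z"
proof -
  define p where "p = csqrt (1 - z) + 1"
  have p: "p \<noteq> 0" "(p - 1) ^ 2 = 1 - z" using csqrt_plus_one_nonzero by (auto simp: p_def)
  have w: "koebe_inverse z = (p - 2) / p" by (simp add: koebe_inverse_def p_def)
  have "1 - koebe_inverse z = 2 / p"
    using p(1) by (simp add: w field_simps)
  hence "-4 * koebe_inverse z * inverse ((1 - koebe_inverse z) ^ 2) = 1 - (p - 1) ^ 2"
    using p(1) by (simp add: w power2_eq_square) (simp add: algebra_simps)
  thus ?thesis by (simp add: p)
qed

text \<open>The continuation is the transported series H evaluated at the inverse of the Koebe map. Near 0
  it agrees with the Gauss series by associativity of composition, and then on the whole unit disc,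
  because the Taylor series of a function holomorphic there converges to it.\<close>

lemma hypergeo_continuation_exists:
  assumes c: "c \<notin> \<int>\<^sub>\<le>\<^sub>0"
  shows "\<exists>f. is_hypergeo_continuation a b c f"
proof -
  define H where "H = fps_compose (hypergeo_fps a b c) koebe_fps"
  have radius: "fps_conv_radius H \<ge> 1" unfolding H_def by (rule koebe_conv_radius[OF c])
  define f where "f = eval_fps H \<circ> koebe_inverse"
  have zero: "0 \<in> hypergeo_cut_plane" using unit_ball_subset_cut_plane by auto
  have hol: "f holomorphic_on hypergeo_cut_plane"
    unfolding f_def
  proof (rule holomorphic_on_compose_gen[OF koebe_inverse_holomorphic])
    show "eval_fps H holomorphic_on ball 0 1"
      by (rule holomorphic_on_eval_fps) (use radius ball_eball_mono[of 1 "fps_conv_radius H" 0] in \<open>simp add: one_ereal_def\<close>)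
  qed (use norm_koebe_inverse_less_1 in auto)
  have "koebe_inverse analytic_on {0}"
    using koebe_inverse_holomorphic zero hypergeo_cut_plane_open analytic_at by blast
  then obtain W where W: "koebe_inverse has_fps_expansion W"
    using analytic_at_imp_has_fps_expansion_0 by blast
  have W0: "fps_nth W 0 = 0"
    using has_fps_expansion_imp_0_eq_fps_nth_0[OF W] by (simp add: koebe_inverse_def)
  have "(\<lambda>w. -4 * w * inverse ((1 - w) ^ 2)) has_fps_expansion koebe_fps"
    unfolding koebe_fps_def power2_eq_square by (intro fps_expansion_intros) auto
  hence "((\<lambda>w. -4 * w * inverse ((1 - w) ^ 2)) \<circ> koebe_inverse) has_fps_expansion fps_compose koebe_fps W"
    by (rule has_fps_expansion_compose[OF _ W W0])
  hence "(\<lambda>z. z) has_fps_expansion fps_compose koebe_fps W"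
    by (simp only: o_def koebe_inverse)
  hence X: "fps_compose koebe_fps W = fps_X"
    using fps_expansion_unique_complex has_fps_expansion_fps_X by blast
  have "eval_fps H has_fps_expansion H"
    by (rule eval_fps_has_fps_expansion) (use radius in \<open>auto intro: less_le_trans[of _ 1]\<close>)
  hence "f has_fps_expansion fps_compose H W"
    unfolding f_def by (rule has_fps_expansion_compose[OF _ W W0])
  also have "fps_compose H W = hypergeo_fps a b c"
    unfolding H_def by (subst fps_compose_assoc[symmetric]) (simp_all add: W0 X)
  finally have F: "f has_fps_expansion hypergeo_fps a b c" .
  have "(\<lambda>n. fps_nth (hypergeo_fps a b c) n * z ^ n) sums f z" if "norm z < 1" for z
    by (rule has_fps_expansion_imp_sums_complex[OF F, where r = 1])
      (use that hol unit_ball_subset_cut_plane in \<open>auto simp: one_ereal_def intro: holomorphic_on_subset\<close>)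
  hence "is_hypergeo_continuation a b c f"
    using hol by (simp add: is_hypergeo_continuation_def hypergeo_fps_def hypergeo_coeff_def)
  thus ?thesis by blast
qed

section \<open>The moment recurrence at argument -1\<close>

lemma norm_mult_power_le: "norm (u * z ^ n) \<le> norm u" if "norm z \<le> 1" for u z :: complex
  using mult_left_mono[OF power_le_one[OF norm_ge_zero that], of "norm u" n]
  by (simp add: norm_mult norm_power)

text \<open>The moment series converges absolutely on the unit circle, so its values inside the disc tend to
  those on the boundary.\<close>

lemma moment_sum_tendsto_boundary:
  assumes c: "c \<notin> \<int>\<^sub>\<le>\<^sub>0" and re: "Re (c - a - b) > -1" and M: "Re M > 0"
    and z: "\<And>k. norm (z k) \<le> 1" "z \<longlonglongrightarrow> w"
  shows "(\<lambda>k. \<Sum>n. hypergeo_coeff a b c n / (of_nat n + M) * z k ^ n)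
           \<longlonglongrightarrow> (\<Sum>n. hypergeo_coeff a b c n / (of_nat n + M) * w ^ n)"
proof (rule tannerys_theorem[THEN conjunct2, THEN conjunct2])
  show "summable (\<lambda>n. norm (hypergeo_coeff a b c n / (of_nat n + M)))"
    by (rule hypergeo_moment_summable[OF c re M])
  have "norm (hypergeo_coeff a b c n / (of_nat n + M) * z k ^ n) \<le>
          norm (hypergeo_coeff a b c n / (of_nat n + M))" for n k
    using z(1) by (rule norm_mult_power_le)
  thus "\<forall>\<^sub>F (n, k) in at_top \<times>\<^sub>F sequentially.
      norm (hypergeo_coeff a b c n / (of_nat n + M) * z k ^ n) \<le> norm (hypergeo_coeff a b c n / (of_nat n + M))"
    by (simp add: case_prod_unfold)
qed (auto intro!: tendsto_intros z(2) simp: of_nat_add_nonzero[OF M])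

text \<open>Applying the Euler operator multiplies the coefficient of index n by n.\<close>

lemma power_series_theta_sums:
  fixes f :: "complex \<Rightarrow> complex"
  assumes hol: "f holomorphic_on ball 0 1"
    and f: "\<And>z. norm z < 1 \<Longrightarrow> (\<lambda>n. t n * z ^ n) sums f z"
    and z: "norm z < 1"
  shows "(\<lambda>n. of_nat n * t n * z ^ n) sums (z * deriv f z)"
proof -
  have "\<forall>\<^sub>F u in nhds 0. u \<in> ball (0 :: complex) 1" by (rule eventually_nhds_in_open) auto
  hence "f has_fps_expansion Abs_fps t"
    by (intro has_fps_expansionI) (auto elim!: eventually_mono intro: f)
  hence "(\<lambda>z. z * deriv f z) has_fps_expansion fps_theta (Abs_fps t)"
    by (intro fps_expansion_intros)
  moreover have "(\<lambda>z. z * deriv f z) holomorphic_on eball 0 1"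
    using hol by (auto simp: one_ereal_def intro!: holomorphic_intros)
  ultimately have "(\<lambda>n. fps_nth (fps_theta (Abs_fps t)) n * z ^ n) sums (z * deriv f z)"
    by (rule has_fps_expansion_imp_sums_complex) (use z in \<open>simp add: one_ereal_def\<close>)
  moreover have "fps_nth (fps_theta (Abs_fps t)) n = of_nat n * t n" for n
    by (cases n) simp_all
  ultimately show ?thesis by simp
qed

text \<open>Both sides are the sum of the same sequence u, once written from index 0 and once from index 1:
  u(0) = 0, and the recursion of the coefficients lets u(n + 1) be expanded by partial fractions
  at n = -(M + 1), while u(n) is expanded at n = -M.\<close>

lemma moment_identity_inside:
  fixes a b c M :: complex
  assumes c: "c \<notin> \<int>\<^sub>\<le>\<^sub>0" and re: "Re (c - a - b) > -1" and M: "Re M > 0"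
    and hol: "f holomorphic_on ball 0 1"
    and f: "\<And>z. norm z < 1 \<Longrightarrow> (\<lambda>n. hypergeo_coeff a b c n * z ^ n) sums f z"
    and z: "norm z < 1"
  defines "G \<equiv> \<lambda>N. \<Sum>n. hypergeo_coeff a b c n / (of_nat n + N) * z ^ n"
  shows "z * (z * deriv f z + (a + b - M - 1) * f z + (M + 1 - a) * (M + 1 - b) * G (M + 1)) =
           z * deriv f z + (c - 1 - M) * f z + M * (M + 1 - c) * G M"
proof -
  define t where "t = hypergeo_coeff a b c"
  define u where "u = (\<lambda>n. t n * (of_nat n * (of_nat n + c - 1) / (of_nat n + M)) * z ^ n)"
  have G: "(\<lambda>n. t n / (of_nat n + N) * z ^ n) sums G N" if N: "Re N > 0" for N
    unfolding G_def t_def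
  proof (rule summable_sums, rule summable_comparison_test')
    show "summable (\<lambda>n. norm (hypergeo_coeff a b c n / (of_nat n + N)))"
      by (rule hypergeo_moment_summable[OF c re N])
    show "norm (hypergeo_coeff a b c n / (of_nat n + N) * z ^ n) \<le>
          norm (hypergeo_coeff a b c n / (of_nat n + N))" for n
      using less_imp_le[OF z] by (rule norm_mult_power_le)
  qed
  have F: "(\<lambda>n. t n * z ^ n) sums f z" using f[OF z] by (simp add: t_def)
  have F': "(\<lambda>n. of_nat n * t n * z ^ n) sums (z * deriv f z)"
    using power_series_theta_sums[OF hol f z] by (simp add: t_def)
  have M1: "Re (M + 1) > 0" using M by simp
  have "(\<lambda>n. of_nat n * t n * z ^ n + (c - 1 - M) * (t n * z ^ n)
            + M * (M + 1 - c) * (t n / (of_nat n + M) * z ^ n)) sums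
          (z * deriv f z + (c - 1 - M) * f z + M * (M + 1 - c) * G M)"
    by (intro sums_add sums_mult F F' G M)
  moreover have "of_nat n * t n * z ^ n + (c - 1 - M) * (t n * z ^ n)
            + M * (M + 1 - c) * (t n / (of_nat n + M) * z ^ n) = u n" for n
  proof -
    have eq: "of_nat n * (of_nat n + c - 1) / (of_nat n + M) =
            of_nat n + (c - 1 - M) + M * (M + 1 - c) / (of_nat n + M)"
      using of_nat_add_nonzero[OF M, of n] by (simp add: field_simps)
    show ?thesis unfolding u_def eq by (simp add: algebra_simps)
  qed
  ultimately have 1: "u sums (z * deriv f z + (c - 1 - M) * f z + M * (M + 1 - c) * G M)" by simp
  have "(\<lambda>n. z * (of_nat n * t n * z ^ n + (a + b - M - 1) * (t n * z ^ n)
            + (M + 1 - a) * (M + 1 - b) * (t n / (of_nat n + (M + 1)) * z ^ n))) sums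
          (z * (z * deriv f z + (a + b - M - 1) * f z + (M + 1 - a) * (M + 1 - b) * G (M + 1)))"
    by (intro sums_add sums_mult F F' G M1)
  moreover have "z * (of_nat n * t n * z ^ n + (a + b - M - 1) * (t n * z ^ n)
            + (M + 1 - a) * (M + 1 - b) * (t n / (of_nat n + (M + 1)) * z ^ n)) = u (Suc n)" for n
  proof -
    define N where "N = (of_nat n :: complex)"
    have nz: "N + (M + 1) \<noteq> 0" "c + N \<noteq> 0" "1 + N \<noteq> 0"
      using of_nat_add_nonzero[OF M1, of n] add_of_nat_nonzero[OF c, of n] of_nat_neq_0[of n]
      by (auto simp: N_def)
    have "u (Suc n) = z * z ^ n * (t n * ((a + N) * (b + N) / (N + (M + 1))))"
      using nz by (simp add: u_def t_def hypergeo_coeff_Suc N_def[symmetric] divide_simps add_ac)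
    also have "(a + N) * (b + N) / (N + (M + 1)) =
            N + (a + b - M - 1) + (M + 1 - a) * (M + 1 - b) / (N + (M + 1))"
      using nz by (simp add: field_simps)
    finally have uS: "u (Suc n) = z * z ^ n *
        (t n * (N + (a + b - M - 1) + (M + 1 - a) * (M + 1 - b) / (N + (M + 1))))" .
    have "z * (N * x * y + e * (x * y) + P * (x / D * y)) = z * y * (x * (N + e + P / D))"
      for x y e P D by (simp add: algebra_simps)
    thus ?thesis unfolding uS N_def[symmetric] .
  qed
  ultimately have "(\<lambda>n. u (Suc n)) sums
     (z * (z * deriv f z + (a + b - M - 1) * f z + (M + 1 - a) * (M + 1 - b) * G (M + 1)))" by simp
  hence "u sums (z * (z * deriv f z + (a + b - M - 1) * f z + (M + 1 - a) * (M + 1 - b) * G (M + 1)) + u 0)"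
    by (rule sums_Suc)
  moreover have "u 0 = 0" by (simp add: u_def)
  ultimately show ?thesis using sums_unique2[OF 1] by simp
qed

text \<open>At -1 the two terms with the derivative on either side of the identity inside the disc do not
  cancel but add up to the -2 in the definition of E. The point -1 is interior to the cut plane, so
  that the function and its derivative are continuous there.\<close>

lemma moment_recurrence_minus:
  assumes c: "c \<notin> \<int>\<^sub>\<le>\<^sub>0" and re: "Re (c - a - b) > -1" and M: "Re M > 0"
  shows "- ((M + 1 - a) * (M + 1 - b) * (\<Sum>n. hypergeo_coeff a b c n / (of_nat n + (M + 1)) * (-1) ^ n))
           - M * (M + 1 - c) * (\<Sum>n. hypergeo_coeff a b c n / (of_nat n + M) * (-1) ^ n)
         = E_minus M a b c"
proof -
  define f where "f = gauss_hypergeo a b c"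
  define G where "G = (\<lambda>N z. \<Sum>n. hypergeo_coeff a b c n / (of_nat n + N) * z ^ n)"
  have "is_hypergeo_continuation a b c f"
    unfolding f_def gauss_hypergeo_def by (rule someI_ex[OF hypergeo_continuation_exists[OF c]])
  hence hol: "f holomorphic_on hypergeo_cut_plane"
    and f: "\<And>z. norm z < 1 \<Longrightarrow> (\<lambda>n. hypergeo_coeff a b c n * z ^ n) sums f z"
    by (auto simp: is_hypergeo_continuation_def hypergeo_coeff_def)
  have hol1: "f holomorphic_on ball 0 1"
    using hol unit_ball_subset_cut_plane by (rule holomorphic_on_subset)
  have in_cut: "-1 \<in> hypergeo_cut_plane"
    by (simp add: cut_plane_iff complex_nonpos_Reals_iff)
  have cont: "isCont f (-1)" "isCont (deriv f) (-1)"
    using hol in_cut hypergeo_cut_plane_open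
    by (auto intro!: continuous_on_interior holomorphic_on_imp_continuous_on holomorphic_deriv
        simp: interior_open)
  \<comment> \<open>A sequence inside the disc that tends to -1 radially.\<close>
  define z where "z = (\<lambda>k. - (of_nat k / of_nat (Suc k)) :: complex)"
  have z: "norm (z k) < 1" for k
  proof -
    have "norm (z k) = real k / real (Suc k)"
      unfolding z_def norm_minus_cancel norm_divide norm_of_nat ..
    thus ?thesis by simp
  qed
  have z_lim: "z \<longlonglongrightarrow> -1" unfolding z_def by (intro tendsto_minus LIMSEQ_n_over_Suc_n)
  have G_lim: "(\<lambda>k. G N (z k)) \<longlonglongrightarrow> G N (-1)" if "Re N > 0" for N
    unfolding G_def by (rule moment_sum_tendsto_boundary[OF c re that less_imp_le[OF z] z_lim])
  have f_lim: "(\<lambda>k. f (z k)) \<longlonglongrightarrow> f (-1)" "(\<lambda>k. deriv f (z k)) \<longlonglongrightarrow> deriv f (-1)"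
    using isCont_tendsto_compose[OF cont(1) z_lim] isCont_tendsto_compose[OF cont(2) z_lim] by auto
  have M1: "Re (M + 1) > 0" using M by simp
  have "(\<lambda>k. z k * (z k * deriv f (z k) + (a + b - M - 1) * f (z k) + (M + 1 - a) * (M + 1 - b) * G (M + 1) (z k)))
      \<longlonglongrightarrow> -1 * (-1 * deriv f (-1) + (a + b - M - 1) * f (-1) + (M + 1 - a) * (M + 1 - b) * G (M + 1) (-1))"
    by (intro tendsto_intros z_lim f_lim G_lim M1)
  moreover have "(\<lambda>k. z k * deriv f (z k) + (c - 1 - M) * f (z k) + M * (M + 1 - c) * G M (z k))
      \<longlonglongrightarrow> -1 * deriv f (-1) + (c - 1 - M) * f (-1) + M * (M + 1 - c) * G M (-1)"
    by (intro tendsto_intros z_lim f_lim G_lim M)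
  moreover have "z k * (z k * deriv f (z k) + (a + b - M - 1) * f (z k) + (M + 1 - a) * (M + 1 - b) * G (M + 1) (z k))
      = z k * deriv f (z k) + (c - 1 - M) * f (z k) + M * (M + 1 - c) * G M (z k)" for k
    unfolding G_def by (rule moment_identity_inside[OF c re M hol1 f z])
  ultimately have eq: "-1 * (-1 * deriv f (-1) + (a + b - M - 1) * f (-1) + (M + 1 - a) * (M + 1 - b) * G (M + 1) (-1))
      = -1 * deriv f (-1) + (c - 1 - M) * f (-1) + M * (M + 1 - c) * G M (-1)"
    by (simp only: LIMSEQ_unique)
  from eq have "- ((M + 1 - a) * (M + 1 - b) * G (M + 1) (-1)) - M * (M + 1 - c) * G M (-1) =
      (c + a + b - 2 * M - 2) * f (-1) - 2 * deriv f (-1)"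
    by algebra
  thus ?thesis by (simp add: G_def E_minus_def f_def)
qed

section \<open>Bell polynomials of harmonic numbers as parameter derivatives\<close>

lemma fps_prod_nth_0: "fps_nth (\<Prod>k<n. f k) 0 = (\<Prod>k<n. fps_nth (f k) 0)"
  for f :: "nat \<Rightarrow> 'a :: comm_semiring_1 fps" and n :: nat
  by (induction n) (simp_all add: fps_mult_nth_0)

text \<open>The derivative of the exponent is the sum of the u / (1 - u t) over u = 1 / (c + k), which is minus
  the logarithmic derivative of the product. So the product P of the two series has derivative 0.\<close>

lemma exp_bell_harmonic_gf:
  fixes c :: complex
  shows "fps_compose (fps_exp 1) (bell_gf_exponent (\<lambda>j. fact (j - 1) * shifted_harmonic j n c)) *
           (\<Prod>k<n. 1 - fps_const (1 / (c + of_nat k)) * fps_X) = 1"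
proof -
  define u where "u = (\<lambda>k. 1 / (c + of_nat k))"
  define A where "A = bell_gf_exponent (\<lambda>j. fact (j - 1) * shifted_harmonic j n c)"
  define R where "R = (\<lambda>n. \<Prod>k<n. 1 - fps_const (u k) * fps_X :: complex fps)"
  define L where "L = (\<lambda>n. \<Sum>k<n. fps_const (u k) * Abs_fps (\<lambda>j. u k ^ j))"
  have A0: "fps_nth A 0 = 0" by (simp add: A_def bell_gf_exponent_def)
  have geo: "Abs_fps (\<lambda>j. v ^ j) * (1 - fps_const v * fps_X) = 1" for v :: complex
  proof (rule fps_ext)
    fix j show "fps_nth (Abs_fps (\<lambda>j. v ^ j) * (1 - fps_const v * fps_X)) j = fps_nth 1 j"
      by (cases j) (simp_all add: right_diff_distrib mult.assoc[symmetric])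
  qed
  have "fps_nth (fps_deriv A) j = fps_nth (L n) j" for j
    by (simp add: A_def L_def bell_gf_exponent_def shifted_harmonic_def fps_sum_nth u_def
        power_divide sum_distrib_left sum_divide_distrib del: of_nat_Suc)
  hence A': "fps_deriv A = L n" by (rule fps_ext)
  have R': "fps_deriv (R n) = - (L n * R n)" for n
  proof (induction n)
    case 0
    show ?case by (simp add: R_def L_def)
  next
    case (Suc n)
    have "fps_deriv (R (Suc n)) =
            - (L n * R n * (1 - fps_const (u n) * fps_X)) - R n * fps_const (u n)"
      using Suc by (simp add: R_def algebra_simps)
    also have "R n * fps_const (u n) =
            R n * fps_const (u n) * (Abs_fps (\<lambda>j. u n ^ j) * (1 - fps_const (u n) * fps_X))"
      by (simp add: geo)
    also have "- (L n * R n * (1 - fps_const (u n) * fps_X)) - \<dots> = - (L (Suc n) * R (Suc n))"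
      by (simp add: R_def L_def algebra_simps)
    finally show ?case .
  qed
  define P where "P = fps_compose (fps_exp 1) A * R n"
  have "fps_deriv (fps_compose (fps_exp 1) A) = fps_compose (fps_exp 1) A * L n"
    using fps_compose_deriv[OF A0, of "fps_exp 1"] A' by simp
  hence "fps_deriv P = 0"
    by (simp add: P_def R' algebra_simps)
  hence "P = fps_const (fps_nth P 0)"
    by (simp add: fps_deriv_eq_0_iff)
  also have "fps_nth P 0 = 1"
    by (simp add: P_def R_def fps_prod_nth_0 fps_mult_nth_0)
  finally show ?thesis by (simp add: P_def A_def R_def u_def)
qed

text \<open>The generating function of the Bell polynomials is (c)_n / (c - t)_n, and the sign (-1)^r comes
  from the inner derivative of c - t.\<close>

lemma bell_harmonic_eq_higher_deriv:
  assumes c: "c \<notin> \<int>\<^sub>\<le>\<^sub>0"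
  shows "bell_harmonic r n c / pochhammer c n =
           (-1) ^ r * (deriv ^^ r) (\<lambda>w. inverse (pochhammer w n)) c"
proof -
  define E where "E = fps_compose (fps_exp 1) (bell_gf_exponent (\<lambda>j. fact (j - 1) * shifted_harmonic j n c))"
  define R where "R = (\<Prod>k<n. 1 - fps_const (1 / (c + of_nat k)) * fps_X :: complex fps)"
  define \<rho> where "\<rho> = (\<lambda>t. \<Prod>k<n. 1 - 1 / (c + of_nat k) * t)"
  define P where "P = pochhammer c n"
  have P: "P \<noteq> 0" using pochhammer_nonzero[OF c] by (simp add: P_def)
  have ER: "E * R = 1" unfolding E_def R_def by (rule exp_bell_harmonic_gf)
  have "\<rho> has_fps_expansion R"
    unfolding \<rho>_def R_def by (intro fps_expansion_intros)
  moreover have R0: "fps_nth R 0 = 1" by (simp add: R_def fps_prod_nth_0)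
  ultimately have "(\<lambda>t. inverse (\<rho> t)) has_fps_expansion inverse R"
    by (intro has_fps_expansion_inverse) auto
  also have "inverse R = E"
    using ER R0 by (metis fps_inverse_unique mult.commute)
  also have "(\<lambda>t. inverse (\<rho> t)) = (\<lambda>t. P * inverse (pochhammer (-1 * t + c) n))"
  proof
    fix t
    have "P * \<rho> t = (\<Prod>k<n. (c + of_nat k) * (1 - 1 / (c + of_nat k) * t))"
      by (simp add: P_def \<rho>_def pochhammer_prod prod.distrib atLeast0LessThan)
    also have "\<dots> = (\<Prod>k<n. -1 * t + c + of_nat k)"
      using add_of_nat_nonzero[OF c] by (intro prod.cong) (auto simp: field_simps)
    also have "\<dots> = pochhammer (-1 * t + c) n"
      by (simp add: pochhammer_prod atLeast0LessThan)
    finally show "inverse (\<rho> t) = P * inverse (pochhammer (-1 * t + c) n)"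
      using P by (metis inverse_mult_distrib mult.assoc mult.left_neutral right_inverse)
  qed
  finally have E: "(\<lambda>t. P * inverse (pochhammer (-1 * t + c) n)) has_fps_expansion E" .
  define T where "T = {w. pochhammer w n \<noteq> (0::complex)}"
  define S where "S = (\<lambda>t. -1 * t + c) -` T"
  have T: "open T" unfolding T_def
    by (intro open_Collect_neq continuous_intros)
  have S: "open S" unfolding S_def
    by (intro open_vimage T continuous_intros)
  have S0: "0 \<in> S" using P by (simp add: S_def T_def P_def)
  have h: "(\<lambda>w. inverse (pochhammer w n)) holomorphic_on T"
    unfolding T_def by (intro holomorphic_intros) auto
  have h': "(\<lambda>t. inverse (pochhammer (-1 * t + c) n)) holomorphic_on S"
    unfolding S_def T_def by (intro holomorphic_intros) auto
  have "bell_harmonic r n c = fact r * fps_nth E r"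
    by (simp add: bell_harmonic_def complete_bell_def E_def)
  also have "\<dots> = (deriv ^^ r) (\<lambda>t. P * inverse (pochhammer (-1 * t + c) n)) 0"
    using fps_nth_fps_expansion[OF E, of r] by simp
  also have "\<dots> = P * (deriv ^^ r) (\<lambda>t. inverse (pochhammer (-1 * t + c) n)) 0"
    by (rule higher_deriv_cmult[OF h' S0 S])
  also have "(deriv ^^ r) (\<lambda>t. inverse (pochhammer (-1 * t + c) n)) 0 =
               (-1) ^ r * (deriv ^^ r) (\<lambda>w. inverse (pochhammer w n)) (-1 * 0 + c)"
    by (rule higher_deriv_compose_linear'[OF h S T S0]) (auto simp: S_def)
  finally show ?thesis using P by (simp add: P_def)
qed

section \<open>Differentiating the moments in the lower parameter\<close>

text \<open>The harmonic moment of order r = 0 with the lower parameter as last argument, since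
  it will be differentiated in it; the letter s stands for m + 1 + \<lambda>.\<close>

definition hypergeo_moment :: "complex \<Rightarrow> complex \<Rightarrow> complex \<Rightarrow> complex \<Rightarrow> complex \<Rightarrow> complex" where
  "hypergeo_moment \<epsilon> s a b c = (\<Sum>n. hypergeo_coeff a b c n / (of_nat n + s) * \<epsilon> ^ n)"

lemma hypergeo_moment_recurrence:
  assumes "\<epsilon> \<in> {1, -1}" and c: "c \<notin> \<int>\<^sub>\<le>\<^sub>0" and re: "Re (c - a - b) > -1" and M: "Re M > 0"
  shows "\<epsilon> * (M + 1 - a) * (M + 1 - b) * hypergeo_moment \<epsilon> (M + 1) a b c
           - M * ((M + 1 - c) * hypergeo_moment \<epsilon> M a b c) = E_base \<epsilon> M a b c"
proof (cases "\<epsilon> = 1")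
  case True
  thus ?thesis using moment_recurrence_plus[OF c re M]
    by (simp add: hypergeo_moment_def E_base_def mult.assoc)
next
  case False
  hence "\<epsilon> = -1" using assms(1) by auto
  thus ?thesis using moment_recurrence_minus[OF c re M] False
    by (simp add: hypergeo_moment_def E_base_def mult.assoc del: minus_diff_eq)
qed

lemma higher_deriv_finite_sum:
  fixes g :: "nat \<Rightarrow> complex \<Rightarrow> complex"
  assumes "\<And>n. g n holomorphic_on S" "open S" "z \<in> S"
  shows "(deriv ^^ r) (\<lambda>w. \<Sum>n<N. g n w) z = (\<Sum>n<N. (deriv ^^ r) (g n) z)"
proof (induction N)
  case (Suc N)
  have "(deriv ^^ r) (\<lambda>w. (\<Sum>n<N. g n w) + g N w) z =
          (deriv ^^ r) (\<lambda>w. \<Sum>n<N. g n w) z + (deriv ^^ r) (g N) z"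
    by (intro higher_deriv_add[of _ S] holomorphic_intros assms)
  thus ?case using Suc by simp
qed simp

text \<open>By the local majorant the series converges uniformly on a disc around c0, so it is holomorphic
  and its derivatives are taken termwise. Only the factor 1 / (c)_n of a term depends on c, and
  its derivatives are the Bell polynomials.\<close>

lemma hypergeo_moment_higher_deriv:
  assumes \<epsilon>: "norm \<epsilon> = 1" and c0: "c0 \<notin> \<int>\<^sub>\<le>\<^sub>0" and re: "Re (c0 - a - b) > -1" and s: "Re s > 0"
  shows "hypergeo_moment \<epsilon> s a b analytic_on {c0}"
    and "(\<lambda>n. \<epsilon> ^ n * pochhammer a n * pochhammer b n / (pochhammer c0 n * fact n)
            * (bell_harmonic r n c0 / (of_nat n + s))) sums
          ((-1) ^ r * (deriv ^^ r) (hypergeo_moment \<epsilon> s a b) c0)"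
proof -
  obtain \<delta> M where \<delta>: "\<delta> > 0" "\<And>c. c \<in> cball c0 \<delta> \<Longrightarrow> c \<notin> \<int>\<^sub>\<le>\<^sub>0"
    and M: "summable (\<lambda>n. M n / of_nat (Suc n))"
      "\<And>c n. c \<in> cball c0 \<delta> \<Longrightarrow> norm (hypergeo_coeff a b c n) \<le> M n"
    using hypergeo_coeff_local_majorant[OF c0 re] by metis
  obtain B where B: "B > 0" "\<And>n. norm (1 / (of_nat n + s)) \<le> B / of_nat (Suc n)"
    using inverse_of_nat_add_le[OF s] by blast
  define K where "K = (\<lambda>n. \<epsilon> ^ n * pochhammer a n * pochhammer b n / (fact n * (of_nat n + s)))"
  define g where "g = (\<lambda>n c. K n * inverse (pochhammer c n))"
  have g: "g n c = hypergeo_coeff a b c n / (of_nat n + s) * \<epsilon> ^ n" for n c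
    by (simp add: g_def K_def hypergeo_coeff_def divide_inverse mult_ac)
  have g_le: "norm (g n c) \<le> B * (M n / of_nat (Suc n))" if "c \<in> ball c0 \<delta>" for n c
  proof -
    have "norm (g n c) = norm (hypergeo_coeff a b c n) * norm (1 / (of_nat n + s))"
      by (simp add: g norm_mult norm_divide norm_power \<epsilon>)
    also have "\<dots> \<le> M n * (B / of_nat (Suc n))"
      using that by (intro mult_mono M(2) B(2) order_trans[OF norm_ge_zero M(2)[of c n]]) auto
    finally show ?thesis by (simp add: mult_ac)
  qed
  have lim: "uniform_limit (ball c0 \<delta>) (\<lambda>N c. \<Sum>n<N. g n c) (\<lambda>c. \<Sum>n. g n c) sequentially"
    using g_le summable_mult[OF M(1), of B] by (rule Weierstrass_m_test)
  have eq: "(\<lambda>c. \<Sum>n. g n c) = hypergeo_moment \<epsilon> s a b"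
    by (simp add: fun_eq_iff hypergeo_moment_def g)
  have inv: "(\<lambda>c. inverse (pochhammer c n)) holomorphic_on ball c0 \<delta>" for n
    using \<delta>(2) by (intro holomorphic_intros) (auto simp: pochhammer_nonzero)
  have hol: "g n holomorphic_on ball c0 \<delta>" for n
    unfolding g_def by (intro holomorphic_intros inv)
  have "hypergeo_moment \<epsilon> s a b holomorphic_on ball c0 \<delta>"
  proof (rule holomorphic_uniform_sequence)
    show "(\<lambda>c. \<Sum>n<N. g n c) holomorphic_on ball c0 \<delta>" for N by (intro holomorphic_intros hol)
    show "\<exists>d>0. cball x d \<subseteq> ball c0 \<delta> \<and>
        uniform_limit (cball x d) (\<lambda>N c. \<Sum>n<N. g n c) (hypergeo_moment \<epsilon> s a b) sequentially"
      if x: "x \<in> ball c0 \<delta>" for x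
    proof -
      obtain d where "d > 0" "cball x d \<subseteq> ball c0 \<delta>"
        using x by (metis open_ball open_contains_cball)
      thus ?thesis using uniform_limit_on_subset[OF lim] eq by auto
    qed
  qed auto
  thus "hypergeo_moment \<epsilon> s a b analytic_on {c0}"
    using \<delta>(1) by (auto simp: analytic_at intro!: exI[of _ "ball c0 \<delta>"])
  have mem: "c0 \<in> ball c0 \<delta>" using \<delta>(1) by simp
  have "(\<lambda>N. (deriv ^^ r) (\<lambda>c. \<Sum>n<N. g n c) c0) \<longlonglongrightarrow> (deriv ^^ r) (\<lambda>c. \<Sum>n. g n c) c0"
    by (rule higher_deriv_complex_uniform_limit[OF lim])
      (use hol mem in \<open>auto intro!: always_eventually holomorphic_intros\<close>)
  hence "(\<lambda>n. (deriv ^^ r) (g n) c0) sums (deriv ^^ r) (hypergeo_moment \<epsilon> s a b) c0"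
    unfolding sums_def eq by (simp add: higher_deriv_finite_sum[OF hol open_ball mem])
  hence "(\<lambda>n. (-1) ^ r * (deriv ^^ r) (g n) c0) sums ((-1) ^ r * (deriv ^^ r) (hypergeo_moment \<epsilon> s a b) c0)"
    by (rule sums_mult)
  moreover have "(-1) ^ r * (deriv ^^ r) (g n) c0 =
      \<epsilon> ^ n * pochhammer a n * pochhammer b n / (pochhammer c0 n * fact n)
            * (bell_harmonic r n c0 / (of_nat n + s))" for n
  proof -
    have "(deriv ^^ r) (g n) c0 = K n * (deriv ^^ r) (\<lambda>c. inverse (pochhammer c n)) c0"
      unfolding g_def by (rule higher_deriv_cmult[OF inv mem open_ball])
    hence "(-1) ^ r * (deriv ^^ r) (g n) c0 = K n * (bell_harmonic r n c0 / pochhammer c0 n)"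
      unfolding bell_harmonic_eq_higher_deriv[OF c0] by (simp add: mult_ac)
    thus ?thesis by (simp add: K_def)
  qed
  ultimately show "(\<lambda>n. \<epsilon> ^ n * pochhammer a n * pochhammer b n / (pochhammer c0 n * fact n)
            * (bell_harmonic r n c0 / (of_nat n + s))) sums
          ((-1) ^ r * (deriv ^^ r) (hypergeo_moment \<epsilon> s a b) c0)" by simp
qed

lemma harmonic_moment_eq:
  assumes "norm \<epsilon> = 1" and "c0 \<notin> \<int>\<^sub>\<le>\<^sub>0" and "Re (c0 - a - b) > -1" and "Re lam > -1"
  shows "harmonic_moment m r \<epsilon> lam a b c0 =
           (-1) ^ r * (deriv ^^ r) (hypergeo_moment \<epsilon> (of_nat m + lam + 1) a b) c0"
proof -
  have "Re (of_nat m + lam + 1) > 0" using assms(4) by simp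
  from hypergeo_moment_higher_deriv(2)[OF assms(1-3) this, of r] show ?thesis
    unfolding harmonic_moment_def by (simp add: sums_iff add_ac)
qed

text \<open>Leibniz's rule; only the first two derivatives of the linear factor, of orders 0 and 1, are
  nonzero.\<close>

lemma higher_deriv_linear_mult:
  fixes f :: "complex \<Rightarrow> complex"
  assumes "f analytic_on {z}"
  shows "(deriv ^^ r) (\<lambda>w. (d - w) * f w) z =
           (d - z) * (deriv ^^ r) f z - of_nat r * (deriv ^^ (r - 1)) f z"
proof (cases r)
  case (Suc k)
  have lin: "(deriv ^^ Suc i) (\<lambda>w. d - w) z = (if i = 0 then -1 else 0)" for i
  proof -
    have "deriv (\<lambda>w. d - w) = (\<lambda>w. -1)"
      by (intro ext DERIV_imp_deriv) (auto intro!: derivative_eq_intros)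
    thus ?thesis unfolding funpow_Suc_right o_def by simp
  qed
  have "(deriv ^^ r) (\<lambda>w. (d - w) * f w) z =
     (\<Sum>i=0..r. of_nat (r choose i) * (deriv ^^ i) (\<lambda>w. d - w) z * (deriv ^^ (r - i)) f z)"
    by (rule higher_deriv_mult_at) (auto intro!: analytic_intros assms)
  also have "\<dots> = (d - z) * (deriv ^^ r) f z +
     (\<Sum>i=0..k. of_nat (r choose Suc i) * (deriv ^^ Suc i) (\<lambda>w. d - w) z * (deriv ^^ (r - Suc i)) f z)"
    unfolding Suc sum.atLeast0_atMost_Suc_shift by simp
  also have "(\<Sum>i=0..k. of_nat (r choose Suc i) * (deriv ^^ Suc i) (\<lambda>w. d - w) z * (deriv ^^ (r - Suc i)) f z) =
     (\<Sum>i=0..k. if i = 0 then - of_nat r * (deriv ^^ (r - 1)) f z else 0)"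
    unfolding lin by (intro sum.cong) auto
  also have "\<dots> = - of_nat r * (deriv ^^ (r - 1)) f z" by simp
  finally show ?thesis by simp
qed simp

text \<open>The recurrence for r = 0 holds on an open set around c0, so that both sides may be differentiated
  r times there. The derivative of the factor M + 1 - c is where the moment of order r - 1 comes from.
  For
  r = 0 it is multiplied by 0, and the truncated difference r - 1 = 0 does no harm.\<close>

lemma harmonic_moment_step:
  fixes j :: nat
  assumes \<epsilon>: "\<epsilon> \<in> {1, -1}" and lam: "Re lam > -1" and c0: "c0 \<notin> \<int>\<^sub>\<le>\<^sub>0" and re: "Re (c0 - a - b) > -1"
  defines "M \<equiv> of_nat (Suc j) + lam"
  shows "\<epsilon> * (M + 1 - a) * (M + 1 - b) * harmonic_moment (Suc j) r \<epsilon> lam a b c0 =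
           M * (M + 1 - c0) * harmonic_moment j r \<epsilon> lam a b c0
           + of_nat r * M * harmonic_moment j (r - 1) \<epsilon> lam a b c0 + E_term \<epsilon> r M a b c0"
proof -
  have n\<epsilon>: "norm \<epsilon> = 1" using \<epsilon> by auto
  have M: "Re M > 0" "Re (M + 1) > 0" using lam by (auto simp: M_def)
  define P where "P = hypergeo_moment \<epsilon> (M + 1) a b"
  define Q where "Q = hypergeo_moment \<epsilon> M a b"
  have an: "P analytic_on {c0}" "Q analytic_on {c0}"
    unfolding P_def Q_def by (intro hypergeo_moment_higher_deriv n\<epsilon> c0 re M)+
  have psi: "harmonic_moment (Suc j) k \<epsilon> lam a b c0 = (-1) ^ k * (deriv ^^ k) P c0"
            "harmonic_moment j k \<epsilon> lam a b c0 = (-1) ^ k * (deriv ^^ k) Q c0" for k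
    unfolding harmonic_moment_eq[OF n\<epsilon> c0 re lam] P_def Q_def M_def by (simp_all add: add_ac)
  have "open (- \<int>\<^sub>\<le>\<^sub>0 \<inter> {c. Re (c - a - b) > -1})"
    by (intro open_Int open_Compl closed_nonpos_Ints open_Collect_less continuous_intros)
  hence "\<forall>\<^sub>F c in nhds c0. c \<in> - \<int>\<^sub>\<le>\<^sub>0 \<inter> {c. Re (c - a - b) > -1}"
    using c0 re by (intro eventually_nhds_in_open) auto
  hence "\<forall>\<^sub>F c in nhds c0. E_base \<epsilon> M a b c =
           \<epsilon> * (M + 1 - a) * (M + 1 - b) * P c - M * ((M + 1 - c) * Q c)"
    unfolding P_def Q_def
    by eventually_elim (use hypergeo_moment_recurrence[OF \<epsilon> _ _ M(1)] in auto)
  hence "(deriv ^^ r) (E_base \<epsilon> M a b) c0 =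
           (deriv ^^ r) (\<lambda>c. \<epsilon> * (M + 1 - a) * (M + 1 - b) * P c - M * ((M + 1 - c) * Q c)) c0"
    by (intro higher_deriv_cong_ev) auto
  also have "\<dots> = (deriv ^^ r) (\<lambda>c. \<epsilon> * (M + 1 - a) * (M + 1 - b) * P c) c0
                    - (deriv ^^ r) (\<lambda>c. M * ((M + 1 - c) * Q c)) c0"
    by (intro higher_deriv_diff_at analytic_intros an)
  also have "(deriv ^^ r) (\<lambda>c. \<epsilon> * (M + 1 - a) * (M + 1 - b) * P c) c0 =
               \<epsilon> * (M + 1 - a) * (M + 1 - b) * (deriv ^^ r) P c0"
    by (rule higher_deriv_cmult'[OF an(1)])
  also have "(deriv ^^ r) (\<lambda>c. M * ((M + 1 - c) * Q c)) c0 = M * (deriv ^^ r) (\<lambda>c. (M + 1 - c) * Q c) c0"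
    by (intro higher_deriv_cmult' analytic_intros an)
  also have "(deriv ^^ r) (\<lambda>c. (M + 1 - c) * Q c) c0 =
               (M + 1 - c0) * (deriv ^^ r) Q c0 - of_nat r * (deriv ^^ (r - 1)) Q c0"
    by (rule higher_deriv_linear_mult[OF an(2)])
  finally have D: "(deriv ^^ r) (E_base \<epsilon> M a b) c0 =
      \<epsilon> * (M + 1 - a) * (M + 1 - b) * (deriv ^^ r) P c0
      - M * ((M + 1 - c0) * (deriv ^^ r) Q c0 - of_nat r * (deriv ^^ (r - 1)) Q c0)" .
  show ?thesis
  proof (cases r)
    case 0
    thus ?thesis using D by (simp add: psi E_term_def)
  next
    case (Suc k)
    thus ?thesis using D by (simp add: psi E_term_def) (simp add: algebra_simps)
  qed
qed

theorem proposition4p3: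
  fixes \<epsilon> a b c0 lam :: complex and r m :: nat
  assumes "\<epsilon> \<in> {1, -1}"
    and "Re lam > -1"
    and "c0 \<notin> \<int>\<^sub>\<le>\<^sub>0"
    and "Re (c0 - a - b) > -1"
    and "\<And>j. 1 \<le> j \<Longrightarrow> j \<le> m \<Longrightarrow>
           (of_nat j + lam + 1 - a) * (of_nat j + lam + 1 - b) \<noteq> 0"
  shows "harmonic_moment m r \<epsilon> lam a b c0 =
           (\<Prod>l=1..m. rho \<epsilon> lam a b c0 l) * harmonic_moment 0 r \<epsilon> lam a b c0
           + (\<Sum>j=1..m.
                ((if r = 0 then 0
                  else of_nat r * (of_nat j + lam) * harmonic_moment (j - 1) (r - 1) \<epsilon> lam a b c0)
                 + E_term \<epsilon> r (of_nat j + lam) a b c0)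
                / (\<epsilon> * (of_nat j + lam + 1 - a) * (of_nat j + lam + 1 - b))
                * (\<Prod>l=j+1..m. rho \<epsilon> lam a b c0 l))"
  using assms(5)
proof (induction m)
  case 0
  show ?case by simp
next
  case (Suc m)
  define A where "A = (\<lambda>j. \<epsilon> * (of_nat j + lam + 1 - a) * (of_nat j + lam + 1 - b))"
  define e where "e = (\<lambda>j. (if r = 0 then 0
                  else of_nat r * (of_nat j + lam) * harmonic_moment (j - 1) (r - 1) \<epsilon> lam a b c0)
                 + E_term \<epsilon> r (of_nat j + lam) a b c0)"
  define R where "R = rho \<epsilon> lam a b c0"
  define \<Psi> where "\<Psi> = (\<lambda>m. harmonic_moment m r \<epsilon> lam a b c0)"
  have IH: "\<Psi> m = (\<Prod>l=1..m. R l) * \<Psi> 0 + (\<Sum>j=1..m. e j / A j * (\<Prod>l=j+1..m. R l))"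
    unfolding \<Psi>_def R_def e_def A_def by (rule Suc.IH) (use Suc.prems in auto)
  have A: "A (Suc m) \<noteq> 0"
    using Suc.prems[of "Suc m"] assms(1) by (auto simp: A_def)
  have "A (Suc m) * \<Psi> (Suc m) =
          (of_nat (Suc m) + lam) * (of_nat (Suc m) + lam + 1 - c0) * \<Psi> m + e (Suc m)"
    using harmonic_moment_step[OF assms(1-4), of m r]
    by (simp add: A_def e_def \<Psi>_def del: of_nat_Suc)
  hence "\<Psi> (Suc m) =
     ((of_nat (Suc m) + lam) * (of_nat (Suc m) + lam + 1 - c0) * \<Psi> m + e (Suc m)) / A (Suc m)"
    using A by (metis nonzero_mult_div_cancel_left)
  also have "\<dots> = R (Suc m) * \<Psi> m + e (Suc m) / A (Suc m)"
    by (simp add: R_def rho_def A_def add_divide_distrib del: of_nat_Suc)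
  also have "\<dots> = (\<Prod>l=1..Suc m. R l) * \<Psi> 0
      + ((\<Sum>j=1..m. e j / A j * (\<Prod>l=j+1..m. R l) * R (Suc m)) + e (Suc m) / A (Suc m))"
    by (simp add: IH algebra_simps sum_distrib_left)
  also have "(\<Sum>j=1..m. e j / A j * (\<Prod>l=j+1..m. R l) * R (Suc m)) + e (Suc m) / A (Suc m) =
      (\<Sum>j=1..Suc m. e j / A j * (\<Prod>l=j+1..Suc m. R l))"
    by (simp add: mult.assoc)
  finally show ?case unfolding \<Psi>_def R_def e_def A_def .
qed

end
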